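(* Let $\hat R$ be a Yang-Baxter matrix of Hecke type on $V\otimes V$ with eigenvalues $q$ and $-q^{-1}$, where $V$ is a finite-dimensional vector space and $q$ is not a root of unity. Let $L=(L^i_j)$ be the matrix of generators of the RLRL-algebra of $\hat R$. Put $L_{\overline1}:=L_1$, $L_{\overline{k}}:=\hat R_{k-1}L_{\overline{k-1}}\hat R_{k-1}^{-1}$ for $k\ge2$, and $$L^{[k]}:=\mathrm{Tr}_{q\,(2\dots k)}(A_kL_{\overline1}\cdots L_{\overline k}),\qquad \sigma_j(L):=\mathrm{Tr}_{q\,(1\dots j)}(A_jL_{\overline1}\cdots L_{\overline j}),\qquad\sigma_0(L):=1.$$ Then the following identities hold: $$k_q\,L^{[k]}=-\sum_{j=0}^{k-1}\sigma_j(L)\,(-L)^{k-j}\qquad\text{for all } k\ge1,$$ where the powers of $L$ are the usual matrix powers.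
   Context: A Yang-Baxter matrix is an invertible operator $\hat R$ on $V\otimes V$ with $\hat R_1\hat R_2\hat R_1=\hat R_2\hat R_1\hat R_2$ on $V^{\otimes3}$, where $\hat R_i$ denotes $\hat R$ acting in the $i$-th and $(i+1)$-st copies of $V$. It is of Hecke type if its spectral decomposition has two projectors, $\hat R=qS-q^{-1}A$; no condition is imposed on the ranks of the projectors $S$ and $A$. $q$-numbers: $k_q:=(q^k-q^{-k})/(q-q^{-1})$. Antisymmetrizers $A_k$ on $V^{\otimes k}$ are defined inductively by $A_1:=I$ and $$A_k:=\frac1{k_q}A_{k-1}\bigl(q^{k-1}-(k-1)_q\hat R_{k-1}\bigr)A_{k-1},$$ where $A_{k-1}$ acts in the copies $1,\dots,k-1$. The RLRL-algebra of $\hat R$ is the algebra generated by the entries $L^i_j$ of a matrix $L$ subject to $\hat RL_1\hat RL_1=L_1\hat RL_1\hat R$, where $L_1$ is $L$ acting in the first copy of $V$. The matrix $D$ is defined by $\mathrm{Tr}_2(\hat RD_2)=I$ (partial trace over the second copy of $V$, with $D_2$ being $D$ acting in the second copy). The $q$-trace of a matrix $Z$ is $\mathrm{Tr}_q(Z):=\mathrm{Tr}(DZ)$, and $\mathrm{Tr}_{q\,(a\dots b)}$ is the $q$-trace over the copies $a,\dots,b$ of $V$ (no trace when $a>b$, so $L^{[1]}=L$).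
   Formalization: The identity is proved with a factor q^j before σ_j(L) in the sum; as printed it fails for k=2, e.g. dim V=1, R=-1/q, D=-q, where it would need q²+1=q+1. D is taken to be the unique solution of Tr_2(R D_2)=I. *)

theory Defs
  imports "HOL-Analysis.Analysis" "HOL-Library.Poly_Mapping"
begin

section \<open>Operators on tensor powers\<close>

text \<open>
  \<open>V\<close> has a basis indexed by \<open>'n::finite\<close>; the basis of its \<open>m\<close>-th tensor power is indexed by the
  lists of length \<open>m\<close>. An operator is its matrix of entries (row index first) in an arbitrary,
  possibly noncommutative, ring; entries outside \<open>tens m \<times> tens m\<close> are 0 for all operators below,
  so that equality of functions is equality of operators. Copies of \<open>V\<close> are numbered from 1,
  hence copy \<open>i\<close> is list position \<open>i - 1\<close>.
\<close>

type_synonym ('n, 'b) tensor_op = "'n list \<Rightarrow> 'n list \<Rightarrow> 'b"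

definition tens :: "nat \<Rightarrow> 'n list set"
  where "tens m = {u. length u = m}"

definition tid :: "nat \<Rightarrow> ('n, 'b::ring_1) tensor_op"
  where "tid m u v = (if u \<in> tens m \<and> u = v then 1 else 0)"

definition tmul ::
    "nat \<Rightarrow> ('n, 'b::ring_1) tensor_op \<Rightarrow> ('n, 'b) tensor_op \<Rightarrow> ('n, 'b) tensor_op"
  where "tmul m X Y u v = (\<Sum>w\<in>tens m. X u w * Y w v)"

definition tprod :: "nat \<Rightarrow> ('n, 'b::ring_1) tensor_op list \<Rightarrow> ('n, 'b) tensor_op"
  where "tprod m Xs = foldr (tmul m) Xs (tid m)"

definition tscale :: "'b::ring_1 \<Rightarrow> ('n, 'b) tensor_op \<Rightarrow> ('n, 'b) tensor_op"
  where "tscale c X u v = c * X u v"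

definition tdiff ::
    "('n, 'b::ring_1) tensor_op \<Rightarrow> ('n, 'b) tensor_op \<Rightarrow> ('n, 'b) tensor_op"
  where "tdiff X Y u v = X u v - Y u v"

definition tmap :: "('a \<Rightarrow> 'b) \<Rightarrow> ('n, 'a) tensor_op \<Rightarrow> ('n, 'b) tensor_op"
  where "tmap f X u v = f (X u v)"

text \<open>\<open>one_site m M i\<close> is \<open>M\<close> acting in copy \<open>i\<close>; \<open>two_site m R i\<close> is \<open>R\<close> acting in copies \<open>i\<close>, \<open>i + 1\<close>.\<close>

definition one_site :: "nat \<Rightarrow> 'b::ring_1 ^'n::finite ^'n \<Rightarrow> nat \<Rightarrow> ('n, 'b) tensor_op"
  where "one_site m M i u v =
    (if u \<in> tens m \<and> v \<in> tens m \<and> (\<forall>l<m. l \<noteq> i - 1 \<longrightarrow> u ! l = v ! l)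
     then M $ (u ! (i - 1)) $ (v ! (i - 1)) else 0)"

definition two_site ::
    "nat \<Rightarrow> 'b::ring_1 ^('n::finite \<times> 'n) ^('n \<times> 'n) \<Rightarrow> nat \<Rightarrow> ('n, 'b) tensor_op"
  where "two_site m R i u v =
    (if u \<in> tens m \<and> v \<in> tens m \<and> (\<forall>l<m. l \<noteq> i - 1 \<and> l \<noteq> i \<longrightarrow> u ! l = v ! l)
     then R $ (u ! (i - 1), u ! i) $ (v ! (i - 1), v ! i) else 0)"

text \<open>\<open>ptrace m a\<close> is the trace over copies \<open>a, \<dots>, m\<close> of an operator on \<open>m\<close> copies, with \<open>1 \<le> a\<close>.
  For \<open>a = m + 1\<close> there is no trace; for \<open>a = 1\<close> the result is a scalar, the entry at \<open>[]\<close>, \<open>[]\<close>.\<close>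

definition ptrace :: "nat \<Rightarrow> nat \<Rightarrow> ('n, 'b::ring_1) tensor_op \<Rightarrow> ('n, 'b) tensor_op"
  where "ptrace m a Z u v =
    (if u \<in> tens (a - 1) \<and> v \<in> tens (a - 1)
     then \<Sum>w\<in>tens (m + 1 - a). Z (u @ w) (v @ w) else 0)"

definition qtrace ::
    "'b::ring_1 ^'n::finite ^'n \<Rightarrow> nat \<Rightarrow> nat \<Rightarrow> ('n, 'b) tensor_op \<Rightarrow> ('n, 'b) tensor_op"
  where "qtrace D m a Z = ptrace m a (tmul m (tprod m (map (one_site m D) [a..<m + 1])) Z)"

section \<open>Yang--Baxter matrices of Hecke type\<close>

definition mat_scale :: "'b::ring_1 \<Rightarrow> 'b ^'n ^'m \<Rightarrow> 'b ^'n ^'m"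
  where "mat_scale c M = (\<chi> i j. c * M $ i $ j)"

definition yang_baxter :: "'a::field ^('n::finite \<times> 'n) ^('n \<times> 'n) \<Rightarrow> bool"
  where "yang_baxter R \<longleftrightarrow> invertible R \<and>
    tprod 3 [two_site 3 R 1, two_site 3 R 2, two_site 3 R 1] =
    tprod 3 [two_site 3 R 2, two_site 3 R 1, two_site 3 R 2]"

definition hecke_type :: "'a::field \<Rightarrow> 'a ^('n::finite \<times> 'n) ^('n \<times> 'n) \<Rightarrow> bool"
  where "hecke_type q R \<longleftrightarrow> (\<exists>S A. S ** S = S \<and> A ** A = A \<and> S ** A = 0 \<and> A ** S = 0 \<and>
    S + A = mat 1 \<and> R = mat_scale q S - mat_scale (inverse q) A)"

definition root_of_unity :: "'a::field \<Rightarrow> bool"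
  where "root_of_unity q \<longleftrightarrow> (\<exists>m\<ge>1. q ^ m = 1)"

definition qnum :: "'a::field \<Rightarrow> nat \<Rightarrow> 'a"
  where "qnum q k = (q ^ k - inverse q ^ k) / (q - inverse q)"

text \<open>\<open>D\<close> is \<^emph>\<open>defined\<close> by \<open>Tr\<^sub>2 (R D\<^sub>2) = I\<close>, i.e. it is the unique solution. Unique solvability of
  this linear system for \<open>D\<close> is skew-invertibility of \<open>R\<close>.\<close>

definition is_D_matrix :: "'a::field ^('n::finite \<times> 'n) ^('n \<times> 'n) \<Rightarrow> 'a ^'n ^'n \<Rightarrow> bool"
  where "is_D_matrix R D \<longleftrightarrow>
    (\<forall>D'. ptrace 2 2 (tmul 2 (two_site 2 R 1) (one_site 2 D' 2)) = tid 1 \<longleftrightarrow> D' = D)"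

text \<open>\<open>antisym q R m k\<close> is the antisymmetrizer \<open>A\<^sub>k\<close> acting in copies \<open>1, \<dots>, k\<close> of the \<open>m \<ge> k\<close> copies;
  index 0 is a dummy.\<close>

fun antisym :: "'a::field \<Rightarrow> 'a ^('n::finite \<times> 'n) ^('n \<times> 'n) \<Rightarrow> nat \<Rightarrow> nat \<Rightarrow> ('n, 'a) tensor_op"
  where
    "antisym q R m 0 = tid m"
  | "antisym q R m (Suc 0) = tid m"
  | "antisym q R m (Suc (Suc k)) = tscale (1 / qnum q (Suc (Suc k)))
      (tprod m
        [antisym q R m (Suc k),
         tdiff (tscale (q ^ Suc k) (tid m)) (tscale (qnum q (Suc k)) (two_site m R (Suc k))),
         antisym q R m (Suc k)])"

section \<open>The RLRL-algebra\<close>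

text \<open>Free unital algebra over \<open>'a\<close> on generators \<open>'g\<close>: the monoid algebra of the free monoid.
  Addition of words is concatenation, as the convolution product of \<^typ>\<open>'w \<Rightarrow>\<^sub>0 'a\<close> requires.\<close>

datatype 'g word = Word (letters: "'g list")

instantiation word :: (type) monoid_add
begin

definition zero_word :: "'g word"
  where "zero_word = Word []"

definition plus_word :: "'g word \<Rightarrow> 'g word \<Rightarrow> 'g word"
  where "plus_word v w = Word (letters v @ letters w)"

instance
  by standard (simp_all add: zero_word_def plus_word_def)

end

type_synonym ('g, 'a) free_alg = "'g word \<Rightarrow>\<^sub>0 'a"

definition free_const :: "'a::field \<Rightarrow> ('g, 'a) free_alg"
  where "free_const c = Poly_Mapping.single 0 c"

definition free_gen :: "'g \<Rightarrow> ('g, 'a::field) free_alg"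
  where "free_gen g = Poly_Mapping.single (Word [g]) 1"

definition free_eval ::
    "('a::field \<Rightarrow> 'b::ring_1) \<Rightarrow> ('g \<Rightarrow> 'b) \<Rightarrow> ('g, 'a) free_alg \<Rightarrow> 'b"
  where "free_eval emb x p =
    (\<Sum>w\<in>Poly_Mapping.keys p. emb (Poly_Mapping.lookup p w) * prod_list (map x (letters w)))"

inductive_set ideal_gen :: "'c::ring_1 set \<Rightarrow> 'c set" for S :: "'c set"
  where
    base: "x \<in> S \<Longrightarrow> x \<in> ideal_gen S"
  | zero: "0 \<in> ideal_gen S"
  | add: "x \<in> ideal_gen S \<Longrightarrow> y \<in> ideal_gen S \<Longrightarrow> x + y \<in> ideal_gen S"
  | mult: "x \<in> ideal_gen S \<Longrightarrow> a * x * b \<in> ideal_gen S"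

text \<open>\<open>emb\<close> makes \<open>'b\<close> a unital associative \<open>'a\<close>-algebra.\<close>

definition algebra_map :: "('a::field \<Rightarrow> 'b::ring_1) \<Rightarrow> bool"
  where "algebra_map emb \<longleftrightarrow> emb 1 = 1 \<and> (\<forall>a b. emb (a + b) = emb a + emb b) \<and>
    (\<forall>a b. emb (a * b) = emb a * emb b) \<and> (\<forall>a x. emb a * x = x * emb a)"

definition rlrl_diff ::
    "('a::field \<Rightarrow> 'b::ring_1) \<Rightarrow> 'a ^('n::finite \<times> 'n) ^('n \<times> 'n) \<Rightarrow> 'b ^'n ^'n \<Rightarrow> ('n, 'b) tensor_op"
  where "rlrl_diff emb R L =
    (let R1 = two_site 2 (map_matrix emb R) 1; L1 = one_site 2 L 1
     in tdiff (tprod 2 [R1, L1, R1, L1]) (tprod 2 [L1, R1, L1, R1]))"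

definition rlrl_ideal ::
    "'a::field ^('n::finite \<times> 'n) ^('n \<times> 'n) \<Rightarrow> ('n \<times> 'n, 'a) free_alg set"
  where "rlrl_ideal R =
    ideal_gen {rlrl_diff free_const R (\<chi> i j. free_gen (i, j)) u v | u v. True}"

text \<open>The algebra \<open>'b\<close> together with \<open>L\<close> is the RLRL-algebra of \<open>R\<close> with its matrix of generators:
  the entries of \<open>L\<close> satisfy the relations, they generate \<open>'b\<close>, and every relation between them
  follows from the defining ones, so that \<open>'b\<close> is the quotient of the free algebra by \<open>rlrl_ideal R\<close>.\<close>

definition rlrl_algebra ::
    "('a::field \<Rightarrow> 'b::ring_1) \<Rightarrow> 'a ^('n::finite \<times> 'n) ^('n \<times> 'n) \<Rightarrow> 'b ^'n ^'n \<Rightarrow> bool"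
  where "rlrl_algebra emb R L \<longleftrightarrow> algebra_map emb \<and>
    (\<forall>u v. rlrl_diff emb R L u v = 0) \<and>
    range (free_eval emb (\<lambda>(i, j). L $ i $ j)) = UNIV \<and>
    (\<forall>p. free_eval emb (\<lambda>(i, j). L $ i $ j) p = 0 \<longrightarrow> p \<in> rlrl_ideal R)"

section \<open>The matrices \<open>L\<^sup>[\<^sup>k\<^sup>]\<close> and the elements \<open>\<sigma>\<^sub>j(L)\<close>\<close>

text \<open>\<open>L_bar emb R L m k\<close> is the \<open>k\<close>-th overlined copy of \<open>L\<close>, acting on \<open>m \<ge> k\<close> copies; index 0 is
  a dummy.\<close>

fun L_bar :: "('a::field \<Rightarrow> 'b::ring_1) \<Rightarrow> 'a ^('n::finite \<times> 'n) ^('n \<times> 'n) \<Rightarrow> 'b ^'n ^'n \<Rightarrow>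
    nat \<Rightarrow> nat \<Rightarrow> ('n, 'b) tensor_op"
  where
    "L_bar emb R L m 0 = tid m"
  | "L_bar emb R L m (Suc 0) = one_site m L 1"
  | "L_bar emb R L m (Suc (Suc k)) = tprod m
      [two_site m (map_matrix emb R) (Suc k), L_bar emb R L m (Suc k),
       two_site m (map_matrix emb (matrix_inv R)) (Suc k)]"

definition antisym_L :: "('a::field \<Rightarrow> 'b::ring_1) \<Rightarrow> 'a \<Rightarrow> 'a ^('n::finite \<times> 'n) ^('n \<times> 'n) \<Rightarrow>
    'b ^'n ^'n \<Rightarrow> nat \<Rightarrow> ('n, 'b) tensor_op"
  where "antisym_L emb q R L k =
    tmul k (tmap emb (antisym q R k k)) (tprod k (map (L_bar emb R L k) [1..<k + 1]))"

definition L_bracket :: "('a::field \<Rightarrow> 'b::ring_1) \<Rightarrow> 'a \<Rightarrow> 'a ^('n::finite \<times> 'n) ^('n \<times> 'n) \<Rightarrow>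
    'a ^'n ^'n \<Rightarrow> 'b ^'n ^'n \<Rightarrow> nat \<Rightarrow> 'b ^'n ^'n"
  where "L_bracket emb q R D L k =
    (\<chi> i j. qtrace (map_matrix emb D) k 2 (antisym_L emb q R L k) [i] [j])"

definition sigma_L :: "('a::field \<Rightarrow> 'b::ring_1) \<Rightarrow> 'a \<Rightarrow> 'a ^('n::finite \<times> 'n) ^('n \<times> 'n) \<Rightarrow>
    'a ^'n ^'n \<Rightarrow> 'b ^'n ^'n \<Rightarrow> nat \<Rightarrow> 'b"
  where "sigma_L emb q R D L j =
    (if j = 0 then 1 else qtrace (map_matrix emb D) j 1 (antisym_L emb q R L j) [] [])"

text \<open>
  With these normalizations \<open>\<sigma>\<^sub>j(L)\<close> enters the Cayley--Hamilton--Newton identities with the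
  coefficient \<open>q\<^sup>j\<close>. For \<open>k = 2\<close>, the relation \<open>R L\<^sub>1 R L\<^sub>1 = L\<^sub>1 R L\<^sub>1 R\<close> turns \<open>(q - R) L\<^sub>1 R L\<^sub>1 R\<^bsup>-1\<^esup>\<close>
  into \<open>q L\<^sub>1 R L\<^sub>1 R\<^bsup>-1\<^esup> - L\<^sub>1 R L\<^sub>1\<close>, whose \<open>q\<close>-trace over copy 2 is \<open>q \<sigma>\<^sub>1(L) L - L\<^sup>2\<close>. The identities
  without \<open>q\<^sup>j\<close> fail already for \<open>dim V = 1\<close>, \<open>R = - q\<^bsup>-1\<^esup>\<close>, \<open>D = - q\<close>, \<open>k = 2\<close>: they would say
  \<open>(q\<^sup>2 + 1) L\<^sup>2 = (q + 1) L\<^sup>2\<close>, with \<open>L\<close> a free generator.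
\<close>

text \<open>The power operation of the type class on \<open>'b ^'n ^'n\<close> is entrywise, hence this definition.\<close>

primrec mat_power :: "'b::ring_1 ^'n::finite ^'n \<Rightarrow> nat \<Rightarrow> 'b ^'n ^'n"
  where
    "mat_power M 0 = mat 1"
  | "mat_power M (Suc k) = M ** mat_power M k"

end

theory Submission
  imports Defs
begin

text \<open>
  The identities follow by induction from
  \<open>k\<^sub>q L\<^sup>[\<^sup>k\<^sup>] = q\<^bsup>k-1\<^esup> \<sigma>\<^bsub>k-1\<^esub>(L) L - (k-1)\<^sub>q L\<^bsup>[k-1]\<^esup> L\<close>. To obtain this recursion, write the antisymmetrizer in its
  mirrored form \<open>k\<^sub>q A\<^sub>k = q\<^bsup>k-1\<^esup> B - (k-1)\<^sub>q B R\<^sub>1 B\<close>, where \<open>B\<close> is \<open>A\<^bsub>k-1\<^esub>\<close> in the copies \<open>2, \<dots>, k\<close>; the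
  mirrored and the original recursion agree because \<open>A\<^sub>k\<close> is characterized by absorbing every \<open>R\<^sub>i\<close>
  with eigenvalue \<open>-q\<^bsup>-1\<^esup>\<close>. With \<open>C = R\<^sub>1\<^bsup>-1\<^esup> \<dots> R\<^bsub>k-1\<^esub>\<^bsup>-1\<^esup>\<close> one has \<open>B = C A\<^bsub>k-1\<^esub> C\<^bsup>-1\<^esup>\<close>, and the reflection
  equation gives \<open>\<Lambda>\<^sub>k = C \<Lambda>\<^bsub>k-1\<^esub> C\<^bsup>-1\<^esup> L\<^sub>1\<close> for the product \<open>\<Lambda>\<^sub>k\<close> of the first \<open>k\<close> overlined copies of \<open>L\<close>.
  Hence \<open>B \<Lambda>\<^sub>k = C (A\<^bsub>k-1\<^esub> \<Lambda>\<^bsub>k-1\<^esub>) C\<^bsup>-1\<^esup> L\<^sub>1\<close>, and the q-trace over the copies \<open>2, \<dots>, k\<close> removes the conjugation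
  by \<open>C\<close> because \<open>Tr\<^sub>q\<^sub>(\<^sub>2\<^sub>)(R\<^bsup>-1\<^esup> X\<^sub>1 R) = Tr\<^sub>q(X) I\<close>. In the term with \<open>B R\<^sub>1 B\<close>, one factor \<open>B\<close> is moved cyclically
  around the trace, which is allowed as \<open>R\<close> commutes with \<open>D\<^sub>1 D\<^sub>2\<close>, and \<open>R\<^sub>1\<close> cancels the first factor of \<open>C\<close>.
\<close>

section \<open>Antisymmetrizers of the Hecke algebra\<close>

text \<open>The unit is an idempotent \<open>e\<close> instead of 1: the operators on m copies will
  be the part of a larger ring cut out by a central idempotent \<open>eu m\<close>, which then takes
  the place of \<open>e\<close>.\<close>

locale scalar_algebra = vector_space scale
  for scale :: "'a::field \<Rightarrow> 'c::ring_1 \<Rightarrow> 'c" +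
  fixes q :: 'a and e :: 'c
  assumes scale_mult_left [simp]: "scale a x * y = scale a (x * y)"
    and scale_mult_right [simp]: "x * scale a y = scale a (x * y)"
    and unit_idem [simp]: "e * e = e"
    and q_nz: "q \<noteq> 0"
    and q_not_root: "\<not> root_of_unity q"
begin

lemma q_diff_nz: "q - inverse q \<noteq> 0"
proof
  assume "q - inverse q = 0"
  then have "q ^ 2 = 1" using q_nz by (simp add: power2_eq_square field_simps)
  with q_not_root show False by (auto simp: root_of_unity_def intro: exI[of _ 2])
qed

lemma qnum_nz: "k \<ge> 1 \<Longrightarrow> qnum q k \<noteq> 0"
proof
  assume k: "k \<ge> 1" and "qnum q k = 0"
  then have "q ^ k = inverse q ^ k" using q_diff_nz by (simp add: qnum_def)
  then have "q ^ (k + k) = 1" using q_nz by (simp add: power_add field_simps)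
  with k q_not_root show False by (auto simp: root_of_unity_def intro: exI[of _ "k + k"])
qed

lemma qnum_0 [simp]: "qnum q 0 = 0" by (simp add: qnum_def)

lemma qnum_1 [simp]: "qnum q (Suc 0) = 1" using q_diff_nz by (simp add: qnum_def)

text \<open>The right-hand side is the value of q^k - k_q R at the eigenvalue -q^-1 of R. This is
  what makes the normalization of the antisymmetrizers the one of a projector.\<close>

lemma qnum_Suc: "qnum q (Suc k) = q ^ k + inverse q * qnum q k"
  using q_diff_nz q_nz by (simp add: qnum_def divide_simps) (simp add: field_simps)

text \<open>The sequence \<open>r\<close> is a parameter, so that shifted and reversed sequences of
  generators have antisymmetrizers too. The value at index 0 serves as the start of the induction in
  \<open>hasym_absorb\<close>.\<close>

fun hasym :: "(nat \<Rightarrow> 'c) \<Rightarrow> nat \<Rightarrow> 'c" where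
  "hasym r 0 = e"
| "hasym r (Suc 0) = e"
| "hasym r (Suc (Suc k)) = scale (1 / qnum q (Suc (Suc k)))
     (hasym r (Suc k) * (scale (q ^ Suc k) e - scale (qnum q (Suc k)) (r (Suc k)))
       * hasym r (Suc k))"

text \<open>These are the relations of the Hecke algebra on n strands, with quadratic relation (r -
  q)(r + q^-1) = 0 and unit \<open>e\<close>.\<close>

definition hecke_gens :: "(nat \<Rightarrow> 'c) \<Rightarrow> nat \<Rightarrow> bool" where
  "hecke_gens r n \<longleftrightarrow>
    (\<forall>i. 1 \<le> i \<and> i < n \<longrightarrow> e * r i = r i \<and> r i * e = r i \<and>
       r i * r i = e + scale (q - inverse q) (r i)) \<and>
    (\<forall>i. 1 \<le> i \<and> Suc i < n \<longrightarrow> r i * r (Suc i) * r i = r (Suc i) * r i * r (Suc i)) \<and>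
    (\<forall>i j. 1 \<le> i \<and> Suc i < j \<and> j < n \<longrightarrow> r i * r j = r j * r i)"

lemma hecke_gens_mono: "hecke_gens r n \<Longrightarrow> m \<le> n \<Longrightarrow> hecke_gens r m"
  unfolding hecke_gens_def by (meson less_le_trans)

lemma hecke_gens_far:
  "hecke_gens r n \<Longrightarrow> 1 \<le> i \<Longrightarrow> Suc i < j \<Longrightarrow> j < n \<Longrightarrow> r i * r j = r j * r i"
  unfolding hecke_gens_def by blast

lemma hecke_gens_shift:
  assumes "hecke_gens r (Suc n)"
  shows "hecke_gens (\<lambda>i. r (Suc i)) n"
  unfolding hecke_gens_def
proof (intro conjI allI impI)
  fix i j assume "1 \<le> i \<and> Suc i < j \<and> j < n"
  then show "r (Suc i) * r (Suc j) = r (Suc j) * r (Suc i)"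
    by (intro hecke_gens_far[OF assms]) auto
qed (use assms in \<open>auto simp: hecke_gens_def\<close>)

lemma hecke_gens_rev:
  assumes "hecke_gens r n"
  shows "hecke_gens (\<lambda>i. r (n - i)) n"
  unfolding hecke_gens_def
proof (intro conjI allI impI)
  fix i assume "1 \<le> i \<and> Suc i < n"
  then have "1 \<le> n - Suc i \<and> Suc (n - Suc i) < n" "Suc (n - Suc i) = n - i" by auto
  then show "r (n - i) * r (n - Suc i) * r (n - i) = r (n - Suc i) * r (n - i) * r (n - Suc i)"
    using assms unfolding hecke_gens_def by metis
next
  fix i j assume "1 \<le> i \<and> Suc i < j \<and> j < n"
  then have "1 \<le> n - j \<and> Suc (n - j) < n - i \<and> n - i < n" by auto
  then show "r (n - i) * r (n - j) = r (n - j) * r (n - i)"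
    using assms unfolding hecke_gens_def by metis
qed (use assms in \<open>auto simp: hecke_gens_def\<close>)

lemma hasym_unit [simp]: "e * hasym r k = hasym r k" "hasym r k * e = hasym r k"
  by (induction r k rule: hasym.induct) (simp_all add: mult.assoc[symmetric], simp_all add: mult.assoc)

lemma hasym_cong: "(\<And>i. 1 \<le> i \<Longrightarrow> i < k \<Longrightarrow> r i = s i) \<Longrightarrow> hasym r k = hasym s k"
  by (induction r k rule: hasym.induct) auto

text \<open>For \<open>s = r\<close> this gives commutation with an antisymmetrizer; for different
  sequences it transports an antisymmetrizer to other copies.\<close>

lemma hasym_intertwine:
  assumes "c * e = e * c" "\<And>i. 1 \<le> i \<Longrightarrow> i < k \<Longrightarrow> c * r i = s i * c"
  shows "c * hasym r k = hasym s k * c"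
  using assms(2)
proof (induction r k rule: hasym.induct)
  case (3 r k)
  let ?T = "\<lambda>r. scale (q ^ Suc k) e - scale (qnum q (Suc k)) (r (Suc k))"
  have IH: "c * hasym r (Suc k) = hasym s (Suc k) * c" using 3 by simp
  have T: "c * ?T r = ?T s * c"
    using 3(3)[of "Suc k"] assms(1) by (simp add: algebra_simps)
  have "c * (hasym r (Suc k) * ?T r * hasym r (Suc k)) = hasym s (Suc k) * ?T s * hasym s (Suc k) * c"
    by (metis IH T mult.assoc)
  then show ?case by simp
qed (use assms in simp_all)

text \<open>Each middle factor of the recursion acts on \<open>y\<close> as the q-number of
  \<open>qnum_Suc\<close> and cancels the normalization.\<close>

lemma hasym_fix_left:
  assumes "e * y = y" "\<And>i. 1 \<le> i \<Longrightarrow> i < k \<Longrightarrow> r i * y = scale (- inverse q) y"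
  shows "hasym r k * y = y"
  using assms(2)
proof (induction r k rule: hasym.induct)
  case (3 r k)
  have IH: "hasym r (Suc k) * y = y" using 3 by simp
  have "hasym r (Suc (Suc k)) * y = scale (1 / qnum q (Suc (Suc k)))
      (hasym r (Suc k) * ((scale (q ^ Suc k) e - scale (qnum q (Suc k)) (r (Suc k)))
       * (hasym r (Suc k) * y)))" by (simp add: mult.assoc)
  also have "\<dots> = scale (1 / qnum q (Suc (Suc k)))
      (scale (q ^ Suc k + inverse q * qnum q (Suc k)) y)"
    using 3(3)[of "Suc k"] assms(1)
    by (simp add: IH left_diff_distrib right_diff_distrib scale_left_distrib mult.commute distrib_left)
  also have "\<dots> = y" using qnum_nz[of "Suc (Suc k)"] by (simp only: qnum_Suc[symmetric]) simp
  finally show ?case .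
qed (use assms in simp_all)

lemma hasym_fix_right:
  assumes "y * e = y" "\<And>i. 1 \<le> i \<Longrightarrow> i < k \<Longrightarrow> y * r i = scale (- inverse q) y"
  shows "y * hasym r k = y"
  using assms(2)
proof (induction r k rule: hasym.induct)
  case (3 r k)
  have IH: "y * hasym r (Suc k) = y" using 3 by simp
  have "y * hasym r (Suc (Suc k)) = scale (1 / qnum q (Suc (Suc k)))
      (y * hasym r (Suc k) * (scale (q ^ Suc k) e - scale (qnum q (Suc k)) (r (Suc k)))
       * hasym r (Suc k))" by (simp add: mult.assoc)
  also have "\<dots> = scale (1 / qnum q (Suc (Suc k)))
      (scale (q ^ Suc k + inverse q * qnum q (Suc k)) y)"
    using 3(3)[of "Suc k"] assms(1)
    by (simp add: IH left_diff_distrib right_diff_distrib scale_left_distrib mult.commute distrib_right)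
  also have "\<dots> = y" using qnum_nz[of "Suc (Suc k)"] by (simp only: qnum_Suc[symmetric]) simp
  finally show ?case .
qed (use assms in simp_all)

text \<open>Here \<open>P\<close>, \<open>Q\<close> are two consecutive antisymmetrizers and
  \<open>s\<close>, \<open>r\<close> two consecutive generators. Expanding only the left factor of Q
  r Q and moving \<open>r\<close> past \<open>P\<close> leaves q^n r Q - n_q P s r Q. A further
  \<open>r\<close> from the left then produces r s r = s r s next to \<open>Q\<close>, where the
  last \<open>s\<close> acts as -q^-1.\<close>

lemma hasym_step_absorb:
  fixes P s r Q :: 'c
  assumes Q: "scale (qnum q (Suc n)) Q = scale (q ^ n) P - scale (qnum q n) (P * s * P)"
    and rP: "r * P = P * r" and PQ: "P * Q = Q" and sQ: "s * Q = scale (- inverse q) Q"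
    and eQ: "e * Q = Q" and rr: "r * r = e + scale (q - inverse q) r"
    and braid: "n \<ge> 1 \<Longrightarrow> r * s * r = s * r * s"
  shows "r * (scale (q ^ Suc n) Q - scale (qnum q (Suc n)) (Q * r * Q))
    = scale (- inverse q) (scale (q ^ Suc n) Q - scale (qnum q (Suc n)) (Q * r * Q))"
proof -
  have QrQ: "scale (qnum q (Suc n)) (Q * r * Q)
      = scale (q ^ n) (r * Q) - scale (qnum q n) (P * s * r * Q)"
  proof -
    have "scale (qnum q (Suc n)) (Q * r * Q) = scale (qnum q (Suc n)) Q * (r * Q)"
      by (simp add: mult.assoc)
    also have "\<dots> = scale (q ^ n) (P * r * Q) - scale (qnum q n) (P * s * (P * r) * Q)"
      by (simp add: Q left_diff_distrib mult.assoc)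
    also have "\<dots> = scale (q ^ n) (r * (P * Q)) - scale (qnum q n) (P * s * r * (P * Q))"
      by (simp add: rP[symmetric] mult.assoc)
    finally show ?thesis by (simp add: PQ)
  qed
  have "scale (qnum q n) (r * (P * s * r * Q)) = scale (qnum q n) (P * (r * s * r) * Q)"
    by (metis rP mult.assoc)
  also have "\<dots> = scale (qnum q n) (P * s * r * (s * Q))"
    using braid by (cases "n = 0") (simp_all add: mult.assoc)
  finally have rsr: "scale (qnum q n) (r * (P * s * r * Q))
      = scale (- inverse q) (scale (qnum q n) (P * s * r * Q))"
    by (simp add: sQ mult.commute)
  have rrQ: "r * (r * Q) = Q + scale (q - inverse q) (r * Q)"
    by (simp add: mult.assoc[symmetric] rr distrib_right eQ)
  have "r * scale (qnum q (Suc n)) (Q * r * Q) =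
      scale (q ^ n) (Q + scale (q - inverse q) (r * Q))
       + scale (inverse q) (scale (q ^ n) (r * Q) - scale (qnum q (Suc n)) (Q * r * Q))"
    using rsr unfolding QrQ by (simp add: right_diff_distrib rrQ)
  also have "\<dots> = scale (q ^ n) Q + scale (q ^ n * (q - inverse q) + inverse q * q ^ n) (r * Q)
      - scale (inverse q) (scale (qnum q (Suc n)) (Q * r * Q))"
    by (simp only: scale_right_distrib scale_right_diff_distrib scale_left_distrib scale_scale)
       (simp add: algebra_simps)
  also have "q ^ n * (q - inverse q) + inverse q * q ^ n = q ^ Suc n"
    by (simp add: algebra_simps)
  finally have "r * scale (qnum q (Suc n)) (Q * r * Q) = scale (q ^ n) Q + scale (q ^ Suc n) (r * Q)
      - scale (inverse q) (scale (qnum q (Suc n)) (Q * r * Q))" .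
  then show ?thesis
    using q_nz by (simp add: right_diff_distrib scale_right_diff_distrib)
qed

text \<open>The mirror image of the preceding argument: now the right factor of Q r Q is
  expanded.\<close>

lemma hasym_step_absorb_right:
  fixes P s r Q :: 'c
  assumes Q: "scale (qnum q (Suc n)) Q = scale (q ^ n) P - scale (qnum q n) (P * s * P)"
    and rP: "r * P = P * r" and QP: "Q * P = Q" and Qs: "Q * s = scale (- inverse q) Q"
    and Qe: "Q * e = Q" and rr: "r * r = e + scale (q - inverse q) r"
    and braid: "n \<ge> 1 \<Longrightarrow> r * s * r = s * r * s"
  shows "(scale (q ^ Suc n) Q - scale (qnum q (Suc n)) (Q * r * Q)) * r
    = scale (- inverse q) (scale (q ^ Suc n) Q - scale (qnum q (Suc n)) (Q * r * Q))"
proof -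
  have QrQ: "scale (qnum q (Suc n)) (Q * r * Q)
      = scale (q ^ n) (Q * r) - scale (qnum q n) (Q * r * s * P)"
  proof -
    have "scale (qnum q (Suc n)) (Q * r * Q) = Q * r * scale (qnum q (Suc n)) Q"
      by simp
    also have "\<dots> = scale (q ^ n) (Q * (r * P)) - scale (qnum q n) (Q * (r * P) * s * P)"
      by (simp add: Q right_diff_distrib mult.assoc)
    also have "\<dots> = scale (q ^ n) (Q * P * r) - scale (qnum q n) (Q * P * r * s * P)"
      by (simp add: rP mult.assoc)
    finally show ?thesis by (simp add: QP)
  qed
  have "scale (qnum q n) (Q * r * s * P * r) = scale (qnum q n) (Q * (r * s * r) * P)"
    by (metis rP mult.assoc)
  also have "\<dots> = scale (qnum q n) (Q * s * r * s * P)"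
    using braid by (cases "n = 0") (simp_all add: mult.assoc)
  finally have rsr: "scale (qnum q n) (Q * r * s * P * r)
      = scale (- inverse q) (scale (qnum q n) (Q * r * s * P))"
    by (simp add: Qs mult.commute)
  have rrQ: "Q * r * r = Q + scale (q - inverse q) (Q * r)"
    by (simp add: mult.assoc rr distrib_left Qe)
  have "scale (qnum q (Suc n)) (Q * r * Q) * r =
      scale (q ^ n) (Q + scale (q - inverse q) (Q * r))
       + scale (inverse q) (scale (q ^ n) (Q * r) - scale (qnum q (Suc n)) (Q * r * Q))"
    using rsr unfolding QrQ by (simp add: left_diff_distrib rrQ)
  also have "\<dots> = scale (q ^ n) Q + scale (q ^ n * (q - inverse q) + inverse q * q ^ n) (Q * r)
      - scale (inverse q) (scale (qnum q (Suc n)) (Q * r * Q))"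
    by (simp only: scale_right_distrib scale_right_diff_distrib scale_left_distrib scale_scale)
       (simp add: algebra_simps)
  also have "q ^ n * (q - inverse q) + inverse q * q ^ n = q ^ Suc n"
    by (simp add: algebra_simps)
  finally have "scale (qnum q (Suc n)) (Q * r * Q) * r = scale (q ^ n) Q + scale (q ^ Suc n) (Q * r)
      - scale (inverse q) (scale (qnum q (Suc n)) (Q * r * Q))" .
  then show ?thesis
    using q_nz by (simp add: left_diff_distrib scale_right_diff_distrib)
qed

lemma hasym_expand:
  assumes "hasym r (Suc k) * hasym r (Suc k) = hasym r (Suc k)"
  shows "scale (qnum q (Suc (Suc k))) (hasym r (Suc (Suc k))) =
    scale (q ^ Suc k) (hasym r (Suc k))
      - scale (qnum q (Suc k)) (hasym r (Suc k) * r (Suc k) * hasym r (Suc k))"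
  using assms qnum_nz[of "Suc (Suc k)"]
  by (simp add: right_diff_distrib left_diff_distrib)

text \<open>The step lemmas treat the last generator and need the two preceding antisymmetrizers,
  hence the strong induction. Every earlier generator is absorbed by the outer factors
  \<open>Q\<close> of the recursion.\<close>

lemma hasym_absorb:
  assumes "hecke_gens r k" "1 \<le> i" "i < k"
  shows "r i * hasym r k = scale (- inverse q) (hasym r k) \<and>
    hasym r k * r i = scale (- inverse q) (hasym r k)"
  using assms
proof (induction k arbitrary: i rule: less_induct)
  case (less k)
  then obtain n where k: "k = Suc (Suc n)"
    by (metis One_nat_def Suc_le_D Suc_lessE Suc_le_eq)
  define P Q where "P = hasym r n" and "Q = hasym r (Suc n)"
  define T where "T = scale (q ^ Suc n) Q - scale (qnum q (Suc n)) (Q * r (Suc n) * Q)"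
  \<comment> \<open>For n = 0 there is no generator of index n. Any element that acts on
    \<open>Q\<close> as -q^-1 can replace it, because its coefficient \<open>qnum q 0\<close> is
    0.\<close>
  define s where "s = (if n = 0 then scale (- inverse q) e else r n)"
  have H: "hecke_gens r (Suc n)" "hecke_gens r n" using less.prems(1) k
    by (auto intro: hecke_gens_mono)
  have absQ: "r j * Q = scale (- inverse q) Q" "Q * r j = scale (- inverse q) Q"
    if "1 \<le> j" "j < Suc n" for j
    using less.IH[of "Suc n" j] H that k by (auto simp: Q_def)
  have absP: "r j * P = scale (- inverse q) P" if "1 \<le> j" "j < n" for j
    using less.IH[of n j] H that k by (auto simp: P_def)
  have QQ: "Q * Q = Q"
    unfolding Q_def by (rule hasym_fix_left) (use absQ in \<open>auto simp: Q_def\<close>)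
  have PP: "P * P = P"
    unfolding P_def by (rule hasym_fix_left) (use absP in \<open>auto simp: P_def\<close>)
  have PQ: "P * Q = Q"
    unfolding P_def by (rule hasym_fix_left) (use absQ in \<open>auto simp: Q_def\<close>)
  have QP: "Q * P = Q"
    unfolding P_def by (rule hasym_fix_right) (use absQ in \<open>auto simp: Q_def\<close>)
  have rn: "e * r (Suc n) = r (Suc n)" "r (Suc n) * e = r (Suc n)"
    "r (Suc n) * r (Suc n) = e + scale (q - inverse q) (r (Suc n))"
    using less.prems(1) k by (auto simp: hecke_gens_def)
  have rP: "r (Suc n) * P = P * r (Suc n)"
    unfolding P_def
    by (rule hasym_intertwine)
      (use hecke_gens_far[OF less.prems(1), of _ "Suc n"] k rn in auto)
  have braid: "r (Suc n) * s * r (Suc n) = s * r (Suc n) * s" if "n \<ge> 1"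
    using less.prems(1) k that by (auto simp: hecke_gens_def s_def)
  have sQ: "s * Q = scale (- inverse q) Q" "Q * s = scale (- inverse q) Q"
    using absQ by (auto simp: s_def Q_def)
  have Qe: "scale (qnum q (Suc n)) Q = scale (q ^ n) P - scale (qnum q n) (P * s * P)"
  proof (cases n)
    case (Suc l)
    then show ?thesis using hasym_expand[of r l] PP by (simp add: P_def Q_def s_def)
  qed (simp add: P_def Q_def)
  have T: "hasym r k = scale (1 / qnum q k) T"
    using hasym_expand[of r n] QQ qnum_nz[of k] k by (simp add: T_def Q_def)
  have "r i * T = scale (- inverse q) T \<and> T * r i = scale (- inverse q) T"
  proof (cases "i = Suc n")
    case True
    show ?thesis unfolding True T_def
      using hasym_step_absorb[of n Q P s, OF Qe rP PQ sQ(1) _ rn(3) braid]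
        hasym_step_absorb_right[of n Q P s, OF Qe rP QP sQ(2) _ rn(3) braid]
      by (simp add: Q_def)
  next
    case False
    then have i: "1 \<le> i" "i < Suc n" using less.prems k by auto
    have "r i * (Q * r (Suc n) * Q) = scale (- inverse q) (Q * r (Suc n) * Q)"
      using absQ(1)[OF i] by (simp add: mult.assoc[symmetric])
    moreover have "Q * r (Suc n) * Q * r i = scale (- inverse q) (Q * r (Suc n) * Q)"
      using absQ(2)[OF i] by (simp add: mult.assoc)
    ultimately show ?thesis
      using absQ[OF i]
      by (simp add: T_def left_diff_distrib right_diff_distrib scale_right_diff_distrib mult.commute)
  qed
  then show ?case by (simp add: T mult.commute)
qed

lemma hasym_idem:
  assumes "hecke_gens r k"
  shows "hasym r k * hasym r k = hasym r k"
  by (rule hasym_fix_left) (use hasym_absorb[OF assms] in auto)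

text \<open>Both antisymmetrizers absorb all generators, so their product equals each of
  them.\<close>

lemma hasym_rev:
  assumes "hecke_gens r k"
  shows "hasym (\<lambda>i. r (k - i)) k = hasym r k"
proof -
  let ?s = "\<lambda>i. r (k - i)"
  have s: "hecke_gens ?s k" by (rule hecke_gens_rev[OF assms])
  have "hasym ?s k * hasym r k = hasym ?s k"
  proof (rule hasym_fix_right)
    fix i assume "1 \<le> i" "i < k"
    then show "hasym ?s k * r i = scale (- inverse q) (hasym ?s k)"
      using hasym_absorb[OF s, of "k - i"] by auto
  qed simp
  moreover have "hasym ?s k * hasym r k = hasym r k"
    by (rule hasym_fix_left) (use hasym_absorb[OF assms] in auto)
  ultimately show ?thesis by simp
qed

text \<open>This is the defining recursion for the reversed generators, whose last one is
  \<open>r 1\<close>. By \<open>hasym_rev\<close> the reversal changes neither the antisymmetrizer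
  on the left nor \<open>B\<close>.\<close>

lemma hasym_mirror:
  assumes "hecke_gens r (Suc (Suc k))"
  defines "B \<equiv> hasym (\<lambda>i. r (Suc i)) (Suc k)"
  shows "scale (qnum q (Suc (Suc k))) (hasym r (Suc (Suc k))) =
    scale (q ^ Suc k) B - scale (qnum q (Suc k)) (B * r 1 * B)"
proof -
  let ?s = "\<lambda>i. r (Suc (Suc k) - i)"
  have "hecke_gens (\<lambda>i. r (Suc i)) (Suc k)"
    using assms by (intro hecke_gens_shift)
  from hasym_rev[OF this] have "hasym (\<lambda>i. r (Suc (Suc k - i))) (Suc k) = B"
    by (simp add: B_def)
  moreover have "hasym (\<lambda>i. r (Suc (Suc k - i))) (Suc k) = hasym ?s (Suc k)"
    by (rule hasym_cong) (simp add: Suc_diff_le)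
  ultimately have B: "hasym ?s (Suc k) = B" by simp
  have "hecke_gens ?s (Suc k)"
    using hecke_gens_rev[OF assms(1)] by (rule hecke_gens_mono) simp
  from hasym_expand[OF hasym_idem[OF this]] show ?thesis
    unfolding B hasym_rev[OF assms(1)] by (simp only: diff_Suc_Suc Suc_diff_le[OF order_refl] diff_self_eq_0 One_nat_def)
qed

end

section \<open>Matrices with a reflection equation\<close>

text \<open>Besides the braid relations of the \<open>r i\<close> there is one relation of type B,
  between \<open>l\<close> and \<open>r 1\<close>. The generators \<open>r i\<close> have inverses,
  but none is assumed for \<open>l\<close>. Only products occur, so the argument takes place in a
  semigroup with \<open>e\<close> as local unit.\<close>

locale reflection_rep =
  fixes e l :: "'c::semigroup_mult" and r r' :: "nat \<Rightarrow> 'c" and n :: nat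
  assumes e_e [simp]: "e * e = e"
    and e_l [simp]: "e * l = l" "l * e = l"
    and e_r [simp]: "e * r i = r i" "r i * e = r i" "e * r' i = r' i" "r' i * e = r' i"
    and r_inv: "1 \<le> i \<Longrightarrow> i < n \<Longrightarrow> r i * r' i = e" "1 \<le> i \<Longrightarrow> i < n \<Longrightarrow> r' i * r i = e"
    and braid: "1 \<le> i \<Longrightarrow> Suc i < n \<Longrightarrow> r i * r (Suc i) * r i = r (Suc i) * r i * r (Suc i)"
    and far: "1 \<le> i \<Longrightarrow> Suc i < j \<Longrightarrow> j < n \<Longrightarrow> r i * r j = r j * r i"
    and l_far: "1 < i \<Longrightarrow> i < n \<Longrightarrow> r i * l = l * r i"
    and reflection: "1 < n \<Longrightarrow> r 1 * l * r 1 * l = l * r 1 * l * r 1"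
begin

text \<open>\<open>ell k\<close> is the overlined copy number \<open>k + 1\<close> of \<open>l\<close>, and \<open>Lam k\<close> is the product of the first \<open>k\<close> of them.\<close>

primrec ell :: "nat \<Rightarrow> 'c" where
  "ell 0 = l"
| "ell (Suc k) = r (Suc k) * ell k * r' (Suc k)"

primrec Lam :: "nat \<Rightarrow> 'c" where
  "Lam 0 = e"
| "Lam (Suc k) = Lam k * ell k"

text \<open>A Coxeter-type element written in the inverse generators. Conjugation by it shifts the
  generators by one copy, see \<open>cox_conj\<close>.\<close>

primrec cox :: "nat \<Rightarrow> 'c" where
  "cox 0 = e"
| "cox (Suc j) = cox j * r' (Suc j)"

primrec cox_inv :: "nat \<Rightarrow> 'c" where
  "cox_inv 0 = e"
| "cox_inv (Suc j) = r (Suc j) * cox_inv j"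

lemma commute_mult: "a * x = x * a \<Longrightarrow> a * y = y * a \<Longrightarrow> a * (x * y) = (x * y) * (a :: 'c)"
  by (metis mult.assoc)

text \<open>Turns an equation between short products into a rewrite rule inside a longer product
  associated to the right.\<close>

lemma mult_cong_assoc:
  fixes a b c :: 'c
  shows "a * b = p * q \<Longrightarrow> a * (b * x) = p * (q * x)"
    and "a * b * c = p * q * s \<Longrightarrow> a * (b * (c * x)) = p * (q * (s * x))"
  by (metis mult.assoc)+

lemma commute_inv:
  assumes "a * r i = r i * a" "1 \<le> i" "i < n" "e * a = a" "a * e = a"
  shows "a * r' i = r' i * a"
proof -
  have "a * r' i = r' i * r i * a * r' i" using assms r_inv by simp
  also have "\<dots> = r' i * a * (r i * r' i)" by (simp only: mult.assoc mult_cong_assoc(1)[OF assms(1)])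
  also have "\<dots> = r' i * a" using assms r_inv by (simp add: mult.assoc)
  finally show ?thesis .
qed

lemma e_ell [simp]: "e * ell k = ell k" "ell k * e = ell k"
  by (induction k) (simp_all add: mult.assoc[symmetric], simp_all add: mult.assoc)

lemma e_Lam [simp]: "e * Lam k = Lam k" "Lam k * e = Lam k"
  by (induction k) (simp_all add: mult.assoc[symmetric], simp_all add: mult.assoc)

lemma e_cox [simp]: "e * cox k = cox k" "cox k * e = cox k"
  by (induction k) (simp_all add: mult.assoc[symmetric], simp_all add: mult.assoc)

lemma e_cox_inv [simp]: "e * cox_inv k = cox_inv k" "cox_inv k * e = cox_inv k"
  by (induction k) (simp_all add: mult.assoc[symmetric], simp_all add: mult.assoc)

lemma braid_inv:
  assumes "1 \<le> i" "Suc i < n"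
  shows "r (Suc i) * r' i * r' (Suc i) = r' i * r' (Suc i) * r i"
proof -
  have i: "r i * r' i = e" "r' i * r i = e" "r (Suc i) * r' (Suc i) = e" "r' (Suc i) * r (Suc i) = e"
    using assms r_inv by auto
  have "r (Suc i) * r' i * r' (Suc i) = r' i * (r' (Suc i) * r (Suc i)) * r i * r (Suc i) * r' i * r' (Suc i)"
    by (simp only: i e_r)
  also have "\<dots> = r' i * r' (Suc i) * (r (Suc i) * r i * r (Suc i)) * r' i * r' (Suc i)"
    by (simp only: mult.assoc)
  also have "\<dots> = r' i * r' (Suc i) * (r i * r (Suc i) * r i) * r' i * r' (Suc i)"
    using braid[OF assms] by simp
  also have "\<dots> = r' i * r' (Suc i) * r i * (r (Suc i) * ((r i * r' i) * r' (Suc i)))"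
    by (simp only: mult.assoc)
  also have "\<dots> = r' i * r' (Suc i) * r i" by (simp only: i e_r mult.assoc)
  finally show ?thesis .
qed

lemma ell_commute_upper: "Suc k < i \<Longrightarrow> i < n \<Longrightarrow> r i * ell k = ell k * r i"
proof (induction k)
  case (Suc k)
  have rr: "r i * r (Suc k) = r (Suc k) * r i" using far[of "Suc k" i] Suc.prems by simp
  have rr': "r i * r' (Suc k) = r' (Suc k) * r i"
    by (rule commute_inv[OF rr]) (use Suc.prems in auto)
  show ?case unfolding ell.simps by (intro commute_mult rr rr' Suc.IH) (use Suc.prems in auto)
qed (use l_far in auto)

text \<open>In the critical case k = i + 1, the braid relation turns \<open>r i\<close> into
  \<open>r (i + 1)\<close> across the two generators on the left of \<open>ell (i - 1)\<close>. That
  generator commutes with \<open>ell (i - 1)\<close>, and \<open>braid_inv\<close> turns it back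
  into \<open>r i\<close> on the right.\<close>

lemma ell_commute_lower: "1 \<le> i \<Longrightarrow> i < k \<Longrightarrow> k < n \<Longrightarrow> r i * ell k = ell k * r i"
proof (induction k)
  case (Suc k)
  show ?case
  proof (cases "i = k")
    case False
    have rr: "r i * r (Suc k) = r (Suc k) * r i" using far[of i "Suc k"] Suc.prems False by simp
    have rr': "r i * r' (Suc k) = r' (Suc k) * r i"
      by (rule commute_inv[OF rr]) (use Suc.prems in auto)
    show ?thesis unfolding ell.simps
      by (intro commute_mult rr rr' Suc.IH) (use Suc.prems False in auto)
  next
    case True
    then obtain j where k: "k = Suc j" using Suc.prems by (cases k) auto
    let ?a = "r k" and ?b = "r (Suc k)" and ?a' = "r' k" and ?b' = "r' (Suc k)" and ?x = "ell j"
    have br: "?a * ?b * ?a = ?b * ?a * ?b" using braid[of k] Suc.prems True by simp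
    have br': "?b * ?a' * ?b' = ?a' * ?b' * ?a" using braid_inv[of k] Suc.prems True by simp
    have x: "?b * ?x = ?x * ?b" using ell_commute_upper[of j "Suc k"] Suc.prems k by simp
    have "?a * ell (Suc k) = (?a * ?b * ?a) * ?x * ?a' * ?b'" by (simp add: k mult.assoc)
    also have "\<dots> = ?b * ?a * (?b * ?x) * ?a' * ?b'" by (simp only: mult.assoc mult_cong_assoc(2)[OF br])
    also have "\<dots> = ?b * ?a * ?x * (?b * ?a' * ?b')"
      by (simp only: mult.assoc mult_cong_assoc(1)[OF x])
    also have "\<dots> = ell (Suc k) * ?a" unfolding br' by (simp add: k mult.assoc)
    finally show ?thesis using True by simp
  qed
qed simp

text \<open>Every overlined copy satisfies the reflection equation with the next generator. In the
  induction, \<open>aba\<close> and \<open>brb\<close> gather the two factors \<open>?x\<close>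
  around a single \<open>?a\<close>, since \<open>?b\<close> commutes with \<open>?x\<close>; the
  equation for \<open>ell k\<close> then applies in the middle.\<close>

lemma ell_reflection:
  "Suc k < n \<Longrightarrow> r (Suc k) * ell k * r (Suc k) * ell k = ell k * r (Suc k) * ell k * r (Suc k)"
proof (induction k)
  case (Suc k)
  let ?a = "r (Suc k)" and ?b = "r (Suc (Suc k))" and ?a' = "r' (Suc k)" and ?b' = "r' (Suc (Suc k))"
    and ?x = "ell k"
  have i: "?a * ?a' = e" "?a' * ?a = e" "?b * ?b' = e" "?b' * ?b = e"
    using Suc.prems r_inv by auto
  have br: "?a * ?b * ?a = ?b * ?a * ?b" using braid[of "Suc k"] Suc.prems by simp
  have br': "?b * ?a' * ?b' = ?a' * ?b' * ?a" using braid_inv[of "Suc k"] Suc.prems by simp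
  have x: "?b * ?x = ?x * ?b" using ell_commute_upper[of k "Suc (Suc k)"] Suc.prems by simp
  have x': "?b' * ?x = ?x * ?b'"
    using commute_inv[of ?x "Suc (Suc k)"] x Suc.prems by simp
  have refl: "?a * ?x * ?a * ?x = ?x * ?a * ?x * ?a" using Suc by simp
  have aba: "?a' * ?b * ?a = ?b * ?a * ?b'"
  proof -
    have "?a' * ?b * ?a = ?a' * (?b * ?a * ?b) * ?b'" by (simp only: i e_r mult.assoc)
    also have "\<dots> = (?a' * ?a) * ?b * ?a * ?b'" by (simp only: br[symmetric]) (simp only: mult.assoc)
    finally show ?thesis by (simp only: i e_r)
  qed
  have brb: "?a * ?b' * ?a' = ?b' * ?a' * ?b"
  proof -
    have "?a * ?b' * ?a' = ?b' * ?a' * (?a * (?b * ?a)) * ?b' * ?a'"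
    proof -
      have "?b' * ?a' * (?a * (?b * ?a)) * ?b' * ?a' = ?b' * (?a' * ?a) * ?b * ?a * ?b' * ?a'"
        by (simp only: mult.assoc)
      also have "\<dots> = ?a * ?b' * ?a'" by (simp only: i e_r)
      finally show ?thesis by simp
    qed
    also have "?a * (?b * ?a) = ?b * ?a * ?b" using br by (simp only: mult.assoc)
    also have "?b' * ?a' * (?b * ?a * ?b) * ?b' * ?a' = ?b' * ?a' * ?b * (?a * ((?b * ?b') * ?a'))"
      by (simp only: mult.assoc)
    also have "\<dots> = ?b' * ?a' * ?b" by (simp only: i e_r mult.assoc)
    finally show ?thesis .
  qed
  have "?b * ell (Suc k) * ?b * ell (Suc k) = ?b * ?a * ?x * (?a' * ?b * ?a) * ?x * ?a'"
    by (simp add: mult.assoc)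
  also have "\<dots> = ?b * ?a * (?x * ?b) * ?a * (?b' * ?x) * ?a'" by (simp only: aba) (simp only: mult.assoc)
  also have "\<dots> = (?b * ?a * ?b) * ?x * ?a * ?x * ?b' * ?a'"
    by (simp only: mult.assoc mult_cong_assoc(1)[OF x[symmetric]] mult_cong_assoc(1)[OF x'])
  also have "\<dots> = ?a * ?b * (?a * ?x * ?a * ?x) * ?b' * ?a'"
    by (simp only: mult.assoc mult_cong_assoc(2)[OF br[symmetric]])
  also have "\<dots> = ?a * ?b * ?x * ?a * ?x * (?a * ?b' * ?a')" by (simp only: refl) (simp only: mult.assoc)
  also have "\<dots> = ?a * (?b * ?x) * ?a * (?x * ?b') * ?a' * ?b"
    by (simp only: brb) (simp only: mult.assoc)
  also have "\<dots> = ?a * ?x * (?b * ?a * ?b') * ?x * ?a' * ?b"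
    by (simp only: mult.assoc mult_cong_assoc(1)[OF x] mult_cong_assoc(1)[OF x'[symmetric]])
  also have "\<dots> = ?a * ?x * (?a' * ?b * ?a) * ?x * ?a' * ?b" by (simp only: aba)
  also have "\<dots> = ell (Suc k) * ?b * ell (Suc k) * ?b" by (simp add: mult.assoc)
  finally show ?case .
qed (use reflection in simp)

text \<open>The reflection equation multiplied from the right by the inverse generator.\<close>

lemma ell_pair_commute:
  assumes "Suc k < n"
  shows "r (Suc k) * (ell k * ell (Suc k)) = ell k * ell (Suc k) * r (Suc k)"
proof -
  let ?a = "r (Suc k)" and ?a' = "r' (Suc k)" and ?x = "ell k"
  have i: "?a * ?a' = e" "?a' * ?a = e" using assms r_inv by auto
  have "?a * (?x * ell (Suc k)) = (?a * ?x * ?a * ?x) * ?a'" by (simp add: mult.assoc)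
  also have "\<dots> = ?x * ?a * ?x * (?a * ?a')" by (simp only: ell_reflection[OF assms]) (simp only: mult.assoc)
  also have "\<dots> = ?x * ?a * ?x * (?a' * ?a)" by (simp only: i)
  finally show ?thesis by (simp add: mult.assoc)
qed

lemma Lam_commute_upper: "k < i \<Longrightarrow> i < n \<Longrightarrow> r i * Lam k = Lam k * r i"
proof (induction k)
  case (Suc k)
  then show ?case unfolding Lam.simps by (intro commute_mult ell_commute_upper Suc.IH) auto
qed simp

text \<open>The generator \<open>r i\<close> commutes with the pair
  \<open>ell (i - 1) * ell i\<close> and with each of the other factors separately.\<close>

lemma Lam_commute: "1 \<le> i \<Longrightarrow> i < k \<Longrightarrow> k \<le> n \<Longrightarrow> r i * Lam k = Lam k * r i"
proof (induction k)
  case (Suc k)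
  show ?case
  proof (cases "i = k")
    case False
    then show ?thesis unfolding Lam.simps using Suc.prems
      by (intro commute_mult ell_commute_lower Suc.IH) auto
  next
    case True
    then obtain j where k: "k = Suc j" using Suc.prems by (cases k) auto
    have "r k * Lam j = Lam j * r k" using Suc.prems by (intro Lam_commute_upper) (auto simp: k)
    moreover have "r k * (ell j * ell k) = ell j * ell k * r k"
      using Suc.prems ell_pair_commute[of j] k by simp
    ultimately have "r k * (Lam j * (ell j * ell k)) = Lam j * (ell j * ell k) * r k"
      by (rule commute_mult)
    then show ?thesis by (simp add: True k mult.assoc)
  qed
qed simp

lemma cox_cox_inv: "j < n \<Longrightarrow> cox j * cox_inv j = e" "j < n \<Longrightarrow> cox_inv j * cox j = e"
proof (induction j)
  case (Suc j)
  {
    case 1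
    have "cox (Suc j) * cox_inv (Suc j) = cox j * (r' (Suc j) * r (Suc j)) * cox_inv j" by (simp add: mult.assoc)
    then show ?case using Suc 1 r_inv by simp
  next
    case 2
    have "cox_inv (Suc j) * cox (Suc j) = r (Suc j) * (cox_inv j * cox j) * r' (Suc j)" by (simp add: mult.assoc)
    then show ?case using Suc 2 r_inv by simp
  }
qed simp_all

lemma ell_eq_conj: "ell k = cox_inv k * l * cox k"
  by (induction k) (simp_all add: mult.assoc)

lemma Lam_commute_cox: "j < k \<Longrightarrow> k \<le> n \<Longrightarrow> Lam k * cox j = cox j * Lam k"
proof (induction j)
  case (Suc j)
  have "Lam k * r (Suc j) = r (Suc j) * Lam k" using Lam_commute Suc.prems by simp
  then have "Lam k * r' (Suc j) = r' (Suc j) * Lam k" by (rule commute_inv) (use Suc.prems in auto)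
  then show ?case unfolding cox.simps by (intro commute_mult Suc.IH) (use Suc.prems in auto)
qed simp

text \<open>For j = k + 1, the reflection equation yields
  \<open>Lam (Suc j) = r' j * Lam j * r j * ell k\<close>. Writing \<open>ell k\<close> as a
  conjugate of \<open>l\<close> leaves \<open>cox k\<close> at the right end. Since
  \<open>cox k\<close> commutes with \<open>Lam (Suc j)\<close>, it can be multiplied on from the
  left instead and cancelled on the right.\<close>

lemma Lam_Suc_conj: "Suc j \<le> n \<Longrightarrow> Lam (Suc j) = cox j * Lam j * cox_inv j * l"
proof (cases j)
  case (Suc k)
  assume n: "Suc j \<le> n"
  let ?a = "r (Suc k)" and ?a' = "r' (Suc k)" and ?x = "ell k"
  have i: "?a * ?a' = e" "?a' * ?a = e" using n r_inv Suc by auto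
  have "?a * Lam (Suc j) = (?a * Lam k) * ?x * ?a * ?x * ?a'" by (simp add: Suc mult.assoc)
  also have "?a * Lam k = Lam k * ?a" using Lam_commute_upper[of k "Suc k"] n Suc by simp
  also have "Lam k * ?a * ?x * ?a * ?x * ?a' = Lam k * (?a * ?x * ?a * ?x) * ?a'" by (simp only: mult.assoc)
  also have "\<dots> = Lam k * ?x * ?a * ?x * (?a * ?a')"
    using ell_reflection[of k] n Suc by (simp add: mult.assoc)
  also have "\<dots> = Lam j * ?a * ?x" by (simp add: i Suc mult.assoc)
  finally have "?a' * ?a * Lam (Suc j) = ?a' * Lam j * ?a * ?x" by (simp add: mult.assoc)
  then have 1: "Lam (Suc j) = ?a' * Lam j * ?a * cox_inv k * l * cox k"
    by (simp only: i e_Lam ell_eq_conj mult.assoc)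
  have "Lam (Suc j) * cox k = cox k * ?a' * Lam j * ?a * cox_inv k * l * cox k"
    using Lam_commute_cox[of k "Suc j"] n Suc 1 by (simp only: mult.assoc)
  then have "Lam (Suc j) * cox k * cox_inv k = cox j * Lam j * cox_inv j * l * (cox k * cox_inv k)"
    by (simp add: Suc mult.assoc)
  then show ?thesis
    using cox_cox_inv(1)[of k] n Suc by (simp only: mult.assoc e_Lam e_l)
qed simp

lemma cox_commute_upper: "Suc j < i \<Longrightarrow> i < n \<Longrightarrow> r i * cox j = cox j * r i"
proof (induction j)
  case (Suc j)
  have "r i * r (Suc j) = r (Suc j) * r i" using far[of "Suc j" i] Suc.prems by simp
  then have "r i * r' (Suc j) = r' (Suc j) * r i" by (rule commute_inv) (use Suc.prems in auto)
  then show ?case unfolding cox.simps by (intro commute_mult Suc.IH) (use Suc.prems in auto)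
qed simp

text \<open>For i = j - 1 this is \<open>braid_inv\<close>, carried past the earlier factors of
  \<open>cox\<close>. All later factors commute with \<open>r i\<close>.\<close>

lemma cox_conj: "1 \<le> i \<Longrightarrow> i < j \<Longrightarrow> j < n \<Longrightarrow> cox j * r i = r (Suc i) * cox j"
proof (induction j)
  case (Suc j)
  show ?case
  proof (cases "i = j")
    case False
    have "r i * r (Suc j) = r (Suc j) * r i" using far[of i "Suc j"] Suc.prems False by simp
    then have "r i * r' (Suc j) = r' (Suc j) * r i" by (rule commute_inv) (use Suc.prems in auto)
    then have "cox (Suc j) * r i = cox j * r i * r' (Suc j)" by (simp add: mult.assoc)
    then show ?thesis using Suc False by (simp add: mult.assoc)
  next
    case True
    then obtain k where j: "j = Suc k" using Suc.prems by (cases j) auto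
    have "cox (Suc j) * r j = cox k * (r' j * r' (Suc j) * r j)" by (simp add: j mult.assoc)
    also have "\<dots> = (cox k * r (Suc j)) * r' j * r' (Suc j)"
      using braid_inv[of j] Suc.prems True by (simp add: mult.assoc)
    also have "\<dots> = r (Suc j) * cox (Suc j)"
      using cox_commute_upper[of k "Suc j"] Suc.prems j
      by (simp add: mult.assoc mult_cong_assoc(1)[of "r _" "cox k"])
    finally show ?thesis using True by simp
  qed
qed simp

end

section \<open>The graded ring of operators\<close>

lemma finite_tens [simp]: "finite (tens m :: 'n::finite list set)"
  using finite_lists_length_eq[of "UNIV :: 'n set" m] by (simp add: tens_def)

lemma tens_0 [simp]: "tens 0 = {[]}"
  by (auto simp: tens_def)

lemma sum_tens_snoc:
  "(\<Sum>w\<in>tens (Suc m). f w) = (\<Sum>w\<in>tens m. \<Sum>a\<in>UNIV. f (w @ [a :: 'n::finite]))"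
proof -
  have "bij_betw (\<lambda>(w, a). w @ [a :: 'n]) (tens m \<times> UNIV) (tens (Suc m))"
    by (rule bij_betwI[of _ _ _ "\<lambda>w. (butlast w, last w)"])
      (auto simp: tens_def intro: append_butlast_last_id)
  from sum.reindex_bij_betw[OF this, of f] show ?thesis
    by (simp add: sum.cartesian_product split_def)
qed

lemma sum_tens_Cons:
  "(\<Sum>w\<in>tens (Suc m). f w) = (\<Sum>a\<in>UNIV. \<Sum>w\<in>tens m. f ((a :: 'n::finite) # w))"
proof -
  have "bij_betw (\<lambda>(a, w). (a :: 'n) # w) (UNIV \<times> tens m) (tens (Suc m))"
    by (rule bij_betwI[of _ _ _ "\<lambda>w. (hd w, tl w)"]) (auto simp: tens_def length_Suc_conv)
  from sum.reindex_bij_betw[OF this, of f] show ?thesis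
    by (simp add: sum.cartesian_product split_def)
qed

lemma sum_tens_append:
  "(\<Sum>w\<in>tens (p + s). f w) = (\<Sum>x\<in>tens p. \<Sum>y\<in>tens s. f (x @ (y :: 'n::finite list)))"
  by (induction s arbitrary: f) (simp_all add: sum_tens_snoc)

text \<open>The operators on all tensor powers together form a ring with unit, in which \<open>tid m\<close> is a
  central idempotent.\<close>

typedef (overloaded) ('n, 'b) gop =
  "{X :: 'n list \<Rightarrow> 'n list \<Rightarrow> 'b::zero. \<forall>u v. length u \<noteq> length v \<longrightarrow> X u v = 0}"
  morphisms ent Abs_gop
  by (rule exI[of _ "\<lambda>_ _. 0"]) simp

text \<open>Discarding the entries between words of different lengths makes this total; operators
  supported in a single degree are unchanged, see \<open>ent_Gop_tsupp\<close>.\<close>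

definition Gop :: "('n, 'b::ring_1) tensor_op \<Rightarrow> ('n, 'b) gop"
  where "Gop X = Abs_gop (\<lambda>u v. if length u = length v then X u v else 0)"

lemma ent_Gop: "ent (Gop X) u v = (if length u = length v then X u v else 0)"
  unfolding Gop_def by (subst Abs_gop_inverse) auto

lemma ent_graded: "length u \<noteq> length v \<Longrightarrow> ent X u v = 0"
  using ent[of X] by auto

lemma gop_eqI:
  assumes "\<And>u v. length u = length v \<Longrightarrow> ent X u v = ent Y u v"
  shows "X = Y"
proof -
  have "ent X u v = ent Y u v" for u v
    by (cases "length u = length v") (simp_all add: assms ent_graded)
  then have "ent X = ent Y" by (intro ext)
  then show ?thesis by (simp add: ent_inject)
qed

instantiation gop :: (finite, ring_1) ring_1
begin

definition zero_gop :: "('a, 'b) gop" where "0 = Gop (\<lambda>u v. 0)"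
definition one_gop :: "('a, 'b) gop" where "1 = Gop (\<lambda>u v. if u = v then 1 else 0)"
definition plus_gop :: "('a, 'b) gop \<Rightarrow> ('a, 'b) gop \<Rightarrow> ('a, 'b) gop"
  where "X + Y = Gop (\<lambda>u v. ent X u v + ent Y u v)"
definition minus_gop :: "('a, 'b) gop \<Rightarrow> ('a, 'b) gop \<Rightarrow> ('a, 'b) gop"
  where "X - Y = Gop (\<lambda>u v. ent X u v - ent Y u v)"
definition uminus_gop :: "('a, 'b) gop \<Rightarrow> ('a, 'b) gop"
  where "- X = Gop (\<lambda>u v. - ent X u v)"
definition times_gop :: "('a, 'b) gop \<Rightarrow> ('a, 'b) gop \<Rightarrow> ('a, 'b) gop"
  where "X * Y = Gop (\<lambda>u v. \<Sum>w\<in>tens (length u). ent X u w * ent Y w v)"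

lemma ent_0 [simp]: "ent (0 :: ('a, 'b) gop) u v = 0"
  and ent_1: "ent (1 :: ('a, 'b) gop) u v = (if u = v then 1 else 0)"
  and ent_add [simp]: "ent ((X :: ('a, 'b) gop) + Y) u v = ent X u v + ent Y u v"
  and ent_diff [simp]: "ent (X - Y) u v = ent X u v - ent Y u v"
  and ent_minus [simp]: "ent (- X) u v = - ent X u v"
  by (auto simp: zero_gop_def one_gop_def plus_gop_def minus_gop_def uminus_gop_def ent_Gop
      ent_graded)

lemma ent_mult: "ent ((X :: ('a, 'b) gop) * Y) u v = (\<Sum>w\<in>tens (length u). ent X u w * ent Y w v)"
  by (auto simp: times_gop_def ent_Gop ent_graded tens_def)

instance
proof
  fix X Y Z :: "('a, 'b) gop"
  show "X * Y * Z = X * (Y * Z)"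
  proof (rule gop_eqI)
    fix u v :: "'a list"
    have "ent (X * Y * Z) u v =
        (\<Sum>w\<in>tens (length u). \<Sum>x\<in>tens (length u). ent X u x * (ent Y x w * ent Z w v))"
      by (simp add: ent_mult sum_distrib_right mult.assoc)
    also have "\<dots> = (\<Sum>x\<in>tens (length u). \<Sum>w\<in>tens (length u). ent X u x * (ent Y x w * ent Z w v))"
      by (rule sum.swap)
    also have "\<dots> = ent (X * (Y * Z)) u v"
      by (simp add: ent_mult sum_distrib_left tens_def)
    finally show "ent (X * Y * Z) u v = ent (X * (Y * Z)) u v" .
  qed
  show "1 * X = X" "X * 1 = X"
    by (rule gop_eqI; simp add: ent_mult ent_1 if_distrib if_distribR tens_def sum.delta sum.delta'
        finite_tens[unfolded tens_def] cong: if_cong)+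
  show "(0 :: ('a, 'b) gop) \<noteq> 1"
  proof
    assume "(0 :: ('a, 'b) gop) = 1"
    then have "ent (0 :: ('a, 'b) gop) [] [] = ent (1 :: ('a, 'b) gop) [] []" by simp
    then show False by (simp add: ent_1)
  qed
qed (auto intro!: gop_eqI simp: ent_mult algebra_simps sum.distrib)

end

section \<open>Degrees\<close>

definition eu :: "nat \<Rightarrow> ('n::finite, 'b::ring_1) gop"
  where "eu m = Gop (tid m)"

lemma ent_eu: "ent (eu m) u v = (if length u = m \<and> u = v then 1 else 0)"
  by (auto simp: eu_def ent_Gop tid_def tens_def)

lemma ent_eu_mult: "ent (eu m * X) u v = (if length u = m then ent X u v else 0)"
proof -
  have "ent (eu m * X) u v
      = (\<Sum>w\<in>tens (length u). if w = u then (if length u = m then ent X u v else 0) else 0)"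
    unfolding ent_mult by (rule sum.cong) (auto simp: ent_eu)
  then show ?thesis by (simp add: tens_def finite_tens[unfolded tens_def])
qed

lemma ent_mult_eu: "ent (X * eu m) u v = (if length u = m then ent X u v else 0)"
proof -
  have "ent (X * eu m) u v
      = (\<Sum>w\<in>tens (length u). if w = v then (if length v = m then ent X u v else 0) else 0)"
    unfolding ent_mult by (rule sum.cong) (auto simp: ent_eu)
  then show ?thesis by (auto simp: tens_def finite_tens[unfolded tens_def] ent_graded)
qed

lemma eu_central: "X * eu m = eu m * X"
  by (rule gop_eqI) (simp add: ent_mult_eu ent_eu_mult)

lemma eu_idem [simp]: "eu m * eu m = eu m"
  by (rule gop_eqI) (simp add: ent_eu_mult ent_eu)

definition homog :: "nat \<Rightarrow> ('n::finite, 'b::ring_1) gop \<Rightarrow> bool"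
  where "homog m X \<longleftrightarrow> eu m * X = X"

lemma homogD: "homog m X \<Longrightarrow> eu m * X = X" "homog m X \<Longrightarrow> X * eu m = X"
  by (simp_all add: homog_def eu_central)

lemma homog_iff: "homog m X \<longleftrightarrow> (\<forall>u v. length u \<noteq> m \<longrightarrow> ent X u v = 0)"
  unfolding homog_def by (metis ent_eu_mult gop_eqI)

lemma homog_mult: "homog m X \<Longrightarrow> homog m (X * Y)"
  by (simp add: homog_def mult.assoc[symmetric])

lemma homog_eu: "homog m (eu m)"
  by (simp add: homog_def)

lemma homog_ext:
  assumes "homog m X" "homog m Y"
    and "\<And>u v. length u = m \<Longrightarrow> length v = m \<Longrightarrow> ent X u v = ent Y u v"
  shows "X = Y"
  by (rule gop_eqI) (metis assms homog_iff)

definition tsupp :: "nat \<Rightarrow> ('n, 'b::ring_1) tensor_op \<Rightarrow> bool"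
  where "tsupp m X \<longleftrightarrow> (\<forall>u v. \<not> (length u = m \<and> length v = m) \<longrightarrow> X u v = 0)"

lemma homog_Gop: "tsupp m X \<Longrightarrow> homog m (Gop X)"
  by (auto simp: homog_iff ent_Gop tsupp_def)

lemma ent_Gop_tsupp: "tsupp m X \<Longrightarrow> ent (Gop X) = X"
  by (intro ext) (auto simp: tsupp_def ent_Gop)

lemma tsupp_tmul: "tsupp m X \<Longrightarrow> tsupp m Y \<Longrightarrow> tsupp m (tmul m X Y)"
  by (auto simp: tsupp_def tmul_def intro!: sum.neutral)

lemma tsupp_tid: "tsupp m (tid m)"
  by (auto simp: tsupp_def tid_def tens_def)

lemma tsupp_tprod: "(\<And>X. X \<in> set Xs \<Longrightarrow> tsupp m X) \<Longrightarrow> tsupp m (tprod m Xs)"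
  unfolding tprod_def by (induction Xs) (auto intro: tsupp_tmul tsupp_tid)

lemma Gop_tmul: "tsupp m X \<Longrightarrow> Gop (tmul m X Y) = Gop X * Gop Y"
proof (rule gop_eqI)
  fix u v :: "'a list" assume X: "tsupp m X" and len: "length u = length v"
  show "ent (Gop (tmul m X Y)) u v = ent (Gop X * Gop Y) u v"
  proof (cases "length u = m")
    case True
    then show ?thesis using len by (auto simp: ent_Gop ent_mult tmul_def tens_def intro!: sum.cong)
  next
    case False
    then have "X u w = 0" for w using X by (simp add: tsupp_def)
    then show ?thesis by (simp add: ent_Gop ent_mult tmul_def cong: if_cong)
  qed
qed

text \<open>The factor \<open>eu m\<close> is there for the empty product, which is
  \<open>tid m\<close> on the left-hand side but the unit of the whole graded ring in
  \<open>prod_list\<close>.\<close>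

lemma Gop_tprod:
  "(\<And>X. X \<in> set Xs \<Longrightarrow> tsupp m X) \<Longrightarrow> Gop (tprod m Xs) = prod_list (map Gop Xs) * eu m"
proof (induction Xs)
  case (Cons X Xs)
  have "Gop (tprod m (X # Xs)) = Gop (tmul m X (tprod m Xs))" by (simp add: tprod_def)
  also have "\<dots> = Gop X * Gop (tprod m Xs)" using Cons.prems by (intro Gop_tmul) auto
  finally show ?case using Cons by (simp add: mult.assoc)
qed (simp add: tprod_def eu_def)

section \<open>Extension by the identity on a further copy\<close>

text \<open>In tensor notation, \<open>lift X\<close> is X tensor I and \<open>rlift X\<close> is I
  tensor X. Both have no component in degree 0.\<close>

definition lift :: "('n::finite, 'b::ring_1) gop \<Rightarrow> ('n, 'b) gop" where
  "lift X = Gop (\<lambda>u v. if u \<noteq> [] \<and> v \<noteq> [] \<and> last u = last v then ent X (butlast u) (butlast v) else 0)"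

definition rlift :: "('n::finite, 'b::ring_1) gop \<Rightarrow> ('n, 'b) gop" where
  "rlift X = Gop (\<lambda>u v. if u \<noteq> [] \<and> v \<noteq> [] \<and> hd u = hd v then ent X (tl u) (tl v) else 0)"

lemma ent_lift [simp]: "ent (lift X) [] v = 0" "ent (lift X) u [] = 0"
    "ent (lift X) (u @ [a]) (v @ [b]) = (if a = b then ent X u v else 0)"
  by (auto simp: lift_def ent_Gop ent_graded)

lemma ent_rlift [simp]: "ent (rlift X) [] v = 0" "ent (rlift X) u [] = 0"
    "ent (rlift X) (a # u) (b # v) = (if a = b then ent X u v else 0)"
  by (auto simp: rlift_def ent_Gop ent_graded)

lemma gop_eqI_snoc:
  fixes X Y :: "('n::finite, 'b::ring_1) gop"
  assumes "ent X [] [] = ent Y [] []"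
    and "\<And>u v a b. length u = length v \<Longrightarrow> ent X (u @ [a]) (v @ [b]) = ent Y (u @ [a]) (v @ [b])"
  shows "X = Y"
proof (rule gop_eqI)
  fix u v :: "'n list" assume "length u = length v"
  with assms show "ent X u v = ent Y u v"
    by (cases u rule: rev_cases; cases v rule: rev_cases) auto
qed

lemma gop_eqI_Cons:
  fixes X Y :: "('n::finite, 'b::ring_1) gop"
  assumes "ent X [] [] = ent Y [] []"
    and "\<And>u v a b. length u = length v \<Longrightarrow> ent X (a # u) (b # v) = ent Y (a # u) (b # v)"
  shows "X = Y"
proof (rule gop_eqI)
  fix u v :: "'n list" assume "length u = length v"
  with assms show "ent X u v = ent Y u v" by (cases u; cases v) auto
qed

lemma lift_mult: "lift (X * Y) = lift X * lift Y"
proof (rule gop_eqI_snoc)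
  fix u v :: "'a list" and a b
  have "ent (lift X * lift Y) (u @ [a]) (v @ [b]) = (\<Sum>w\<in>tens (length u).
      \<Sum>c\<in>UNIV. if c = a then ent X u w * (if c = b then ent Y w v else 0) else 0)"
    unfolding ent_mult length_append_singleton sum_tens_snoc
    by (intro sum.cong refl) auto
  then show "ent (lift (X * Y)) (u @ [a]) (v @ [b]) = ent (lift X * lift Y) (u @ [a]) (v @ [b])"
    by (simp add: ent_mult)
qed (simp add: ent_mult)

lemma rlift_mult: "rlift (X * Y) = rlift X * rlift Y"
proof (rule gop_eqI_Cons)
  fix u v :: "'a list" and a b
  have "ent (rlift X * rlift Y) (a # u) (b # v) =
      (\<Sum>c\<in>UNIV. if c = a then (\<Sum>w\<in>tens (length u). ent X u w * (if c = b then ent Y w v else 0)) else 0)"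
    unfolding ent_mult list.size add.right_neutral add_Suc_right sum_tens_Cons
    by (rule sum.cong) auto
  then show "ent (rlift (X * Y)) (a # u) (b # v) = ent (rlift X * rlift Y) (a # u) (b # v)"
    by (simp add: ent_mult)
qed (simp add: ent_mult)

lemma lift_diff: "lift (X - Y) = lift X - lift Y"
  by (rule gop_eqI_snoc) simp_all

lemma lift_eu: "lift (eu m) = eu (Suc m)"
  by (rule gop_eqI_snoc) (auto simp: ent_eu)

lemma rlift_eu: "rlift (eu m) = eu (Suc m)"
  by (rule gop_eqI_Cons) (auto simp: ent_eu)

lemma homog_lift: "homog m X \<Longrightarrow> homog (Suc m) (lift X)"
  unfolding homog_def by (metis lift_eu lift_mult)

lemma homog_rlift: "homog m X \<Longrightarrow> homog (Suc m) (rlift X)"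
  unfolding homog_def by (metis rlift_eu rlift_mult)

lemma homog_lifts: "homog m X \<Longrightarrow> homog (m + s) ((lift ^^ s) X)"
  by (induction s) (auto intro: homog_lift)

lemma homog_rlifts: "homog m X \<Longrightarrow> homog (m + s) ((rlift ^^ s) X)"
  by (induction s) (auto intro: homog_rlift)

lemma lifts_mult: "(lift ^^ s) (X * Y) = (lift ^^ s) X * (lift ^^ s) Y"
  by (induction s) (simp_all add: lift_mult)

lemma rlifts_mult: "(rlift ^^ s) (X * Y) = (rlift ^^ s) X * (rlift ^^ s) Y"
  by (induction s) (simp_all add: rlift_mult)

lemma ent_lifts:
  "length x = length y \<Longrightarrow> length x = s \<Longrightarrow>
    ent ((lift ^^ s) X) (u @ x) (v @ y) = (if x = y then ent X u v else 0)"
proof (induction s arbitrary: x y)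
  case (Suc s)
  then obtain x' a y' b where "x = x' @ [a]" "y = y' @ [b]"
    by (metis length_0_conv nat.distinct(1) rev_exhaust)
  then show ?case using Suc.IH[of x' y'] Suc.prems
    by (cases "x' = y'") (simp_all flip: append_assoc)
qed simp

lemma ent_rlifts:
  "length x = length y \<Longrightarrow> length x = s \<Longrightarrow>
    ent ((rlift ^^ s) X) (x @ u) (y @ v) = (if x = y then ent X u v else 0)"
proof (induction s arbitrary: x y)
  case (Suc s)
  then obtain x' a y' b where "x = a # x'" "y = b # y'"
    by (metis length_Suc_conv)
  then show ?case using Suc.IH[of x' y'] Suc.prems by (cases "x' = y'") simp_all
qed simp

text \<open>Operators in complementary sets of copies have products whose entries are products of
  one entry of each. Over a noncommutative ring these agree only if the entries commute, which is
  therefore assumed.\<close>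

lemma lifts_rlifts_commute:
  assumes X: "homog p X" and Y: "homog s Y"
    and comm: "\<And>u v u' v'. ent X u v * ent Y u' v' = ent Y u' v' * ent X u v"
  shows "(lift ^^ s) X * (rlift ^^ p) Y = (rlift ^^ p) Y * (lift ^^ s) X"
proof (rule homog_ext[of "p + s"])
  show "homog (p + s) ((lift ^^ s) X * (rlift ^^ p) Y)" using X by (intro homog_mult homog_lifts)
  show "homog (p + s) ((rlift ^^ p) Y * (lift ^^ s) X)"
    using homog_mult[OF homog_rlifts[OF Y, of p]] by (simp add: add.commute)
next
  fix u v :: "'a list" assume "length u = p + s" "length v = p + s"
  then have "u = take p u @ drop p u" "v = take p v @ drop p v"
    and "length (take p u) = p" "length (take p v) = p" "length (drop p u) = s" "length (drop p v) = s"
    by simp_all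
  then obtain u1 u2 v1 v2 where uv: "u = u1 @ u2" "v = v1 @ v2"
    and len: "length u1 = p" "length v1 = p" "length u2 = s" "length v2 = s"
    by blast
  have "ent ((lift ^^ s) X * (rlift ^^ p) Y) u v = (\<Sum>x\<in>tens p. \<Sum>y\<in>tens s.
      if y = u2 then (if x = v1 then ent X u1 v1 * ent Y u2 v2 else 0) else 0)"
    unfolding ent_mult uv length_append len sum_tens_append
    by (intro sum.cong refl) (auto simp: tens_def len ent_lifts ent_rlifts)
  also have "\<dots> = ent X u1 v1 * ent Y u2 v2"
    using len by (simp add: tens_def finite_tens[unfolded tens_def])
  finally have 1: "ent ((lift ^^ s) X * (rlift ^^ p) Y) u v = ent X u1 v1 * ent Y u2 v2" .
  have "ent ((rlift ^^ p) Y * (lift ^^ s) X) u v = (\<Sum>x\<in>tens p. \<Sum>y\<in>tens s.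
      if y = v2 then (if x = u1 then ent Y u2 v2 * ent X u1 v1 else 0) else 0)"
    unfolding ent_mult uv length_append len sum_tens_append
    by (intro sum.cong refl) (auto simp: tens_def len ent_lifts ent_rlifts)
  also have "\<dots> = ent Y u2 v2 * ent X u1 v1"
    using len by (simp add: tens_def finite_tens[unfolded tens_def])
  finally show "ent ((lift ^^ s) X * (rlift ^^ p) Y) u v = ent ((rlift ^^ p) Y * (lift ^^ s) X) u v"
    using 1 comm by simp
qed

section \<open>The q-trace over the last copy\<close>

text \<open>The trace of D Z in the last copy. As it lowers the degree by one, its powers are
  q-traces over several copies.\<close>

definition qtr :: "'b::ring_1 ^'n::finite ^'n \<Rightarrow> ('n, 'b) gop \<Rightarrow> ('n, 'b) gop" where
  "qtr D Z = Gop (\<lambda>u v. \<Sum>a\<in>UNIV. \<Sum>b\<in>UNIV. D $ a $ b * ent Z (u @ [b]) (v @ [a]))"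

lemma ent_qtr: "ent (qtr D Z) u v = (\<Sum>a\<in>UNIV. \<Sum>b\<in>UNIV. D $ a $ b * ent Z (u @ [b]) (v @ [a]))"
  by (simp add: qtr_def ent_Gop ent_graded)

lemma qtr_diff: "qtr D (X - Y) = qtr D X - qtr D Y"
  by (rule gop_eqI) (simp add: ent_qtr right_diff_distrib sum_subtractf)

lemma qtr_mult_lift: "qtr D (Z * lift X) = qtr D Z * X"
proof (rule gop_eqI)
  fix u v :: "'a list"
  have "ent (Z * lift X) (u @ [b]) (v @ [a]) =
      (\<Sum>w\<in>tens (length u). ent Z (u @ [b]) (w @ [a]) * ent X w v)" for a b
    by (simp add: ent_mult sum_tens_snoc if_distrib cong: if_cong)
  then have "ent (qtr D (Z * lift X)) u v = (\<Sum>a\<in>UNIV. \<Sum>b\<in>UNIV. \<Sum>w\<in>tens (length u).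
      D $ a $ b * ent Z (u @ [b]) (w @ [a]) * ent X w v)"
    by (simp add: ent_qtr sum_distrib_left mult.assoc)
  also have "\<dots> = (\<Sum>a\<in>UNIV. \<Sum>w\<in>tens (length u). \<Sum>b\<in>UNIV.
      D $ a $ b * ent Z (u @ [b]) (w @ [a]) * ent X w v)"
    by (intro sum.cong refl sum.swap)
  also have "\<dots> = (\<Sum>w\<in>tens (length u). \<Sum>a\<in>UNIV. \<Sum>b\<in>UNIV.
      D $ a $ b * ent Z (u @ [b]) (w @ [a]) * ent X w v)"
    by (rule sum.swap)
  also have "\<dots> = ent (qtr D Z * X) u v"
    by (simp add: ent_mult ent_qtr sum_distrib_right)
  finally show "ent (qtr D (Z * lift X)) u v = ent (qtr D Z * X) u v" .
qed

text \<open>A factor on the left has to pass the entries of \<open>D\<close>, hence their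
  centrality.\<close>

lemma qtr_lift_mult:
  assumes "\<And>a b x. D $ a $ b * x = x * D $ a $ b"
  shows "qtr D (lift X * Z) = X * qtr D Z"
proof (rule gop_eqI)
  fix u v :: "'a list"
  have D: "D $ a $ b * (x * y) = x * (D $ a $ b * y)" for a b x y
    by (metis assms mult.assoc)
  have "ent (lift X * Z) (u @ [b]) (v @ [a]) =
      (\<Sum>w\<in>tens (length u). ent X u w * ent Z (w @ [b]) (v @ [a]))" for a b
    by (simp add: ent_mult sum_tens_snoc if_distrib if_distribR cong: if_cong)
  then have "ent (qtr D (lift X * Z)) u v = (\<Sum>a\<in>UNIV. \<Sum>b\<in>UNIV. \<Sum>w\<in>tens (length u).
      ent X u w * (D $ a $ b * ent Z (w @ [b]) (v @ [a])))"
    by (simp add: ent_qtr sum_distrib_left D)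
  also have "\<dots> = (\<Sum>a\<in>UNIV. \<Sum>w\<in>tens (length u). \<Sum>b\<in>UNIV.
      ent X u w * (D $ a $ b * ent Z (w @ [b]) (v @ [a])))"
    by (intro sum.cong refl sum.swap)
  also have "\<dots> = (\<Sum>w\<in>tens (length u). \<Sum>a\<in>UNIV. \<Sum>b\<in>UNIV.
      ent X u w * (D $ a $ b * ent Z (w @ [b]) (v @ [a])))"
    by (rule sum.swap)
  also have "\<dots> = ent (X * qtr D Z) u v"
    by (simp add: ent_mult ent_qtr sum_distrib_left)
  finally show "ent (qtr D (lift X * Z)) u v = ent (X * qtr D Z) u v" .
qed

section \<open>Operators acting in one or two copies\<close>

definition site1 :: "nat \<Rightarrow> 'b::ring_1 ^'n::finite ^'n \<Rightarrow> nat \<Rightarrow> ('n, 'b) gop"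
  where "site1 m M i = Gop (one_site m M i)"

definition site2 :: "nat \<Rightarrow> 'b::ring_1 ^('n::finite \<times> 'n) ^('n \<times> 'n) \<Rightarrow> nat \<Rightarrow> ('n, 'b) gop"
  where "site2 m M i = Gop (two_site m M i)"

lemma tsupp_one_site: "tsupp m (one_site m M i)"
  and tsupp_two_site: "tsupp m (two_site m N i)"
  by (auto simp: tsupp_def one_site_def two_site_def tens_def)

lemma ent_site1: "ent (site1 m M i) = one_site m M i"
  and ent_site2: "ent (site2 m N i) = two_site m N i"
  by (simp_all add: site1_def site2_def ent_Gop_tsupp[OF tsupp_one_site] ent_Gop_tsupp[OF tsupp_two_site])

lemma homog_site1: "homog m (site1 m M i)"
  and homog_site2: "homog m (site2 m N i)"
  by (simp_all add: site1_def site2_def homog_Gop tsupp_one_site tsupp_two_site)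

lemma agree_snoc:
  assumes "length u = m" "length v = m" "P m"
  shows "(\<forall>l<Suc m. P l \<longrightarrow> (u @ [a]) ! l = (v @ [b]) ! l) \<longleftrightarrow> a = b \<and> (\<forall>l<m. P l \<longrightarrow> u ! l = v ! l)"
  using assms by (auto simp: All_less_Suc nth_append)

lemma one_site_snoc:
  assumes "1 \<le> i" "i \<le> m"
  shows "one_site (Suc m) M i (u @ [a]) (v @ [b]) = (if a = b then one_site m M i u v else 0)"
proof (cases "length u = m \<and> length v = m")
  case True
  moreover have "m \<noteq> i - 1" "i - 1 < m" using assms by auto
  ultimately show ?thesis using agree_snoc[of u m v "\<lambda>l. l \<noteq> i - 1" a b]
    by (auto simp add: one_site_def tens_def nth_append)
qed (auto simp: one_site_def tens_def)

lemma two_site_snoc: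
  assumes "1 \<le> i" "i < m"
  shows "two_site (Suc m) M i (u @ [a]) (v @ [b]) = (if a = b then two_site m M i u v else 0)"
proof (cases "length u = m \<and> length v = m")
  case True
  moreover have "m \<noteq> i - 1 \<and> m \<noteq> i" "i - 1 < m" using assms by auto
  ultimately show ?thesis using agree_snoc[of u m v "\<lambda>l. l \<noteq> i - 1 \<and> l \<noteq> i" a b] assms
    by (auto simp add: two_site_def tens_def nth_append)
qed (auto simp: two_site_def tens_def)

lemma two_site_Cons:
  assumes "1 \<le> i" "i < m"
  shows "two_site (Suc m) M (Suc i) (a # u) (b # v) = (if a = b then two_site m M i u v else 0)"
proof -
  obtain j where i: "i = Suc j" using assms by (cases i) auto
  show ?thesis unfolding i by (auto simp: two_site_def tens_def All_less_Suc2)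
qed

lemma two_site_last:
  "two_site (Suc (Suc m)) M (Suc m) (u @ [a, b]) (v @ [c, d]) =
    (if length u = m \<and> u = v then M $ (a, b) $ (c, d) else 0)"
  by (auto simp: two_site_def tens_def nth_append list_eq_iff_nth_eq)

lemma one_site_last:
  "one_site (Suc m) M (Suc m) (u @ [a]) (v @ [b]) = (if length u = m \<and> u = v then M $ a $ b else 0)"
  by (auto simp: one_site_def tens_def nth_append list_eq_iff_nth_eq)

lemma lift_site1: "1 \<le> i \<Longrightarrow> i \<le> m \<Longrightarrow> lift (site1 m M i) = site1 (Suc m) M i"
  by (rule gop_eqI_snoc) (simp add: ent_site1 one_site_def tens_def, simp add: ent_site1 one_site_snoc)

lemma lift_site2: "1 \<le> i \<Longrightarrow> i < m \<Longrightarrow> lift (site2 m M i) = site2 (Suc m) M i"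
  by (rule gop_eqI_snoc) (simp add: ent_site2 two_site_def tens_def, simp add: ent_site2 two_site_snoc)

lemma rlift_site2: "1 \<le> i \<Longrightarrow> i < m \<Longrightarrow> rlift (site2 m M i) = site2 (Suc m) M (Suc i)"
  by (rule gop_eqI_Cons) (simp add: ent_site2 two_site_def tens_def, simp add: ent_site2 two_site_Cons)

lemma lifts_site1: "1 \<le> i \<Longrightarrow> i \<le> m \<Longrightarrow> (lift ^^ s) (site1 m M i) = site1 (m + s) M i"
  by (induction s) (simp_all add: lift_site1)

lemma lifts_site2: "1 \<le> i \<Longrightarrow> i < m \<Longrightarrow> (lift ^^ s) (site2 m M i) = site2 (m + s) M i"
  by (induction s) (simp_all add: lift_site2)

lemma rlifts_site2: "1 \<le> i \<Longrightarrow> i < m \<Longrightarrow> (rlift ^^ s) (site2 m M i) = site2 (m + s) M (i + s)"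
  by (induction s) (simp_all add: rlift_site2)

lemma site2_transport:
  assumes "1 \<le> i" "i < m" "m + p + s = n"
  shows "(lift ^^ s) ((rlift ^^ p) (site2 m M i)) = site2 n M (i + p)"
  using assms by (simp add: rlifts_site2 lifts_site2 add.assoc)

text \<open>Reduced to two copies, because both extensions by the identity are
  multiplicative.\<close>

lemma site2_mult:
  fixes M N :: "'b::ring_1 ^('n::finite \<times> 'n) ^('n \<times> 'n)"
  assumes "1 \<le> i" "i < m"
  shows "site2 m M i * site2 m N i = site2 m (M ** N) i"
proof -
  have two: "site2 2 M 1 * site2 2 N 1 = site2 2 (M ** N) 1"
  proof (rule homog_ext[of 2])
    fix u v :: "'n list" assume "length u = 2" "length v = 2"
    then obtain a b c d where uv: "u = [a, b]" "v = [c, d]"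
      by (auto simp: numeral_2_eq_2 length_Suc_conv)
    have t: "two_site 2 M 1 [a, b] [c, d] = M $ (a, b) $ (c, d)" for M :: "'b ^('n \<times> 'n) ^('n \<times> 'n)" and a b c d :: 'n
      using two_site_last[of 0 M "[]" a b "[]" c d] by (simp add: numeral_2_eq_2)
    have s: "(\<Sum>w\<in>tens (length [a, b]). f w) = (\<Sum>k\<in>UNIV. f [fst k, snd k])" for f :: "'n list \<Rightarrow> 'b"
      by (simp add: sum_tens_Cons sum.cartesian_product split_def flip: UNIV_Times_UNIV)
    show "ent (site2 2 M 1 * site2 2 N 1) u v = ent (site2 2 (M ** N) 1) u v"
      unfolding ent_mult uv
      by (simp only: ent_site2 s t) (simp add: matrix_matrix_mult_def)
  qed (intro homog_mult homog_site2)+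
  have *: "site2 m M i = (lift ^^ (m - i - 1)) ((rlift ^^ (i - 1)) (site2 2 M 1))" for M :: "'b ^('n \<times> 'n) ^('n \<times> 'n)"
    using assms by (simp add: rlifts_site2 lifts_site2)
  show ?thesis unfolding * lifts_mult[symmetric] rlifts_mult[symmetric] two ..
qed

lemma site2_mat_1:
  assumes "1 \<le> i" "i < m"
  shows "site2 m (mat 1) i = (eu m :: ('n::finite, 'b::ring_1) gop)"
proof (rule gop_eqI)
  fix u v :: "'n list" assume len: "length u = length v"
  have "u = v" if "length u = m" "u ! (i - 1) = v ! (i - 1)" "u ! i = v ! i"
    "\<forall>l<m. l \<noteq> i - 1 \<and> l \<noteq> i \<longrightarrow> u ! l = v ! l"
    using that len by (metis nth_equalityI)
  then show "ent (site2 m (mat 1) i) u v = ent (eu m :: ('n, 'b) gop) u v"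
    using len by (auto simp: ent_site2 ent_eu two_site_def tens_def mat_def)
qed

definition smul :: "'b::ring_1 \<Rightarrow> ('n::finite, 'b) gop \<Rightarrow> ('n, 'b) gop"
  where "smul c X = Gop (\<lambda>u v. c * ent X u v)"

lemma ent_smul [simp]: "ent (smul c X) u v = c * ent X u v"
  by (simp add: smul_def ent_Gop ent_graded)

lemma lift_smul: "lift (smul c X) = smul c (lift X)"
  by (rule gop_eqI_snoc) auto

lemma site2_add: "site2 m (M + N) i = site2 m M i + site2 m N i"
  and site2_scale: "site2 m (mat_scale c M) i = smul c (site2 m M i)"
  by (rule gop_eqI; auto simp: ent_site2 two_site_def mat_scale_def)+

text \<open>Cutting the row of copies in front of copy j places the two operators in complementary
  sets.\<close>

lemma site2_far:
  assumes "1 \<le> i" "Suc i < j" "j < m"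
    and "\<And>a b x. M $ a $ b * x = x * M $ a $ b"
  shows "site2 m N i * site2 m M j = site2 m M j * site2 m N i"
proof -
  have 1: "site2 m N i = (lift ^^ (m - (j - 1))) (site2 (j - 1) N i)"
    using assms by (simp add: lifts_site2)
  have 2: "site2 m M j = (rlift ^^ (j - 1)) (site2 (m - (j - 1)) M 1)"
    using assms by (simp add: rlifts_site2)
  show ?thesis unfolding 1 2
    by (rule lifts_rlifts_commute)
      (auto intro: homog_site2 simp: ent_site2 two_site_def[of _ M] assms(4))
qed

lemma site1_far:
  assumes "1 < j" "j < m"
    and "\<And>a b x. M $ a $ b * x = x * M $ a $ b"
  shows "site1 m N 1 * site2 m M j = site2 m M j * site1 m N 1"
proof -
  have 1: "site1 m N 1 = (lift ^^ (m - (j - 1))) (site1 (j - 1) N 1)"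
    using assms by (simp add: lifts_site1)
  have 2: "site2 m M j = (rlift ^^ (j - 1)) (site2 (m - (j - 1)) M 1)"
    using assms by (simp add: rlifts_site2)
  show ?thesis unfolding 1 2
    by (rule lifts_rlifts_commute)
      (auto intro: homog_site2 homog_site1 simp: ent_site2 two_site_def[of _ M] assms(3))
qed

section \<open>Change of coefficients\<close>

definition gmap :: "('a::ring_1 \<Rightarrow> 'b::ring_1) \<Rightarrow> ('n::finite, 'a) gop \<Rightarrow> ('n, 'b) gop"
  where "gmap f X = Gop (\<lambda>u v. f (ent X u v))"

locale coeff_map =
  fixes emb :: "'a::field \<Rightarrow> 'b::ring_1"
  assumes alg: "algebra_map emb"
begin

lemma emb_1 [simp]: "emb 1 = 1"
  and emb_add: "emb (a + b) = emb a + emb b"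
  and emb_mult: "emb (a * b) = emb a * emb b"
  and emb_central: "emb a * x = x * emb a"
  using alg unfolding algebra_map_def by blast+

lemma emb_0 [simp]: "emb 0 = 0"
  using emb_add[of 0 0] by simp

lemma emb_minus: "emb (- a) = - emb a"
  using emb_add[of a "- a"] by (simp add: eq_neg_iff_add_eq_0 add.commute)

lemma emb_diff: "emb (a - b) = emb a - emb b"
  using emb_add[of a "- b"] by (simp add: emb_minus)

lemma emb_sum: "emb (sum f A) = (\<Sum>x\<in>A. emb (f x))"
  by (induction A rule: infinite_finite_induct) (simp_all add: emb_add)

lemma ent_gmap [simp]: "ent (gmap emb X) u v = emb (ent X u v)"
  by (simp add: gmap_def ent_Gop ent_graded)

lemma gmap_mult: "gmap emb (X * Y) = gmap emb X * gmap emb Y"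
  by (rule gop_eqI) (simp add: ent_mult emb_sum emb_mult)

lemma gmap_site2: "gmap emb (site2 m M i) = site2 m (map_matrix emb M) i"
  by (rule gop_eqI) (auto simp: ent_site2 two_site_def map_matrix_def)

lemma gmap_eu: "gmap emb (eu m) = eu m"
  by (rule gop_eqI) (simp add: ent_eu)

lemma gmap_add: "gmap emb (X + Y) = gmap emb X + gmap emb Y"
  by (rule gop_eqI) (simp add: emb_add)

lemma gmap_diff: "gmap emb (X - Y) = gmap emb X - gmap emb Y"
  by (rule gop_eqI) (simp add: emb_diff)

lemma gmap_smul: "gmap emb (smul c X) = smul (emb c) (gmap emb X)"
  by (rule gop_eqI) (simp add: emb_mult)

lemma map_matrix_mult: "map_matrix emb (M ** N) = map_matrix emb M ** map_matrix emb N"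
  by (simp add: map_matrix_def matrix_matrix_mult_def vec_eq_iff emb_sum emb_mult)

lemma gop_scalar_algebra:
  assumes "q \<noteq> 0" "\<not> root_of_unity q"
  shows "scalar_algebra (\<lambda>a :: 'a. smul (emb a) :: ('n::finite, 'b) gop \<Rightarrow> _) q (eu m)"
proof
  fix a b :: 'a and X Y :: "('n, 'b) gop"
  have c: "x * (emb a * y) = emb a * (x * y)" for x y
    by (metis emb_central mult.assoc)
  show "smul (emb a) (X + Y) = smul (emb a) X + smul (emb a) Y"
    "smul (emb (a + b)) X = smul (emb a) X + smul (emb b) X"
    "smul (emb a) (smul (emb b) X) = smul (emb (a * b)) X" "smul (emb 1) X = X"
    by (rule gop_eqI; simp add: distrib_left distrib_right emb_add emb_mult mult.assoc)+
  show "smul (emb a) X * Y = smul (emb a) (X * Y)" "X * smul (emb a) Y = smul (emb a) (X * Y)"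
    by (rule gop_eqI; simp add: ent_mult sum_distrib_left mult.assoc c)+
qed (use assms in auto)

end

section \<open>The matrix D\<close>

lemma sum_pair: "(\<Sum>x\<in>UNIV. f x) = (\<Sum>a\<in>UNIV. \<Sum>b\<in>UNIV. f (a :: 'n::finite, b :: 'm::finite))"
  unfolding sum.cartesian_product by (simp add: split_def)

lemma site2_apply_left:
  assumes "length u = m"
  shows "ent (site2 (Suc (Suc m)) M (Suc m) * Z) (u @ [fst p, snd p]) v =
    (\<Sum>x\<in>UNIV. M $ p $ x * ent Z (u @ [fst x, snd x]) v)"
proof -
  have "ent (site2 (Suc (Suc m)) M (Suc m) * Z) (u @ [fst p, snd p]) v =
    (\<Sum>w\<in>tens m. \<Sum>c\<in>UNIV. \<Sum>s\<in>UNIV. two_site (Suc (Suc m)) M (Suc m) (u @ [fst p, snd p]) (w @ [c, s])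
       * ent Z (w @ [c, s]) v)"
    using assms by (simp add: ent_mult sum_tens_snoc ent_site2)
  also have "\<dots> = (\<Sum>w\<in>tens m. if w = u then \<Sum>c\<in>UNIV. \<Sum>s\<in>UNIV. M $ p $ (c, s) * ent Z (u @ [c, s]) v else 0)"
    using assms by (intro sum.cong refl) (auto simp: two_site_last)
  also have "\<dots> = (\<Sum>c\<in>UNIV. \<Sum>s\<in>UNIV. M $ p $ (c, s) * ent Z (u @ [c, s]) v)"
    using assms by (simp add: tens_def finite_tens[unfolded tens_def])
  finally show ?thesis
    by (simp add: sum.cartesian_product split_def)
qed

lemma site2_apply_right:
  assumes "length v = m" "length u = Suc (Suc m)"
  shows "ent (Z * site2 (Suc (Suc m)) M (Suc m)) u (v @ [fst p, snd p]) =
    (\<Sum>x\<in>UNIV. ent Z u (v @ [fst x, snd x]) * M $ x $ p)"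
proof -
  have "ent (Z * site2 (Suc (Suc m)) M (Suc m)) u (v @ [fst p, snd p]) =
    (\<Sum>w\<in>tens m. \<Sum>c\<in>UNIV. \<Sum>s\<in>UNIV. ent Z u (w @ [c, s]) *
       two_site (Suc (Suc m)) M (Suc m) (w @ [c, s]) (v @ [fst p, snd p]))"
    using assms by (simp add: ent_mult sum_tens_snoc ent_site2)
  also have "\<dots> = (\<Sum>w\<in>tens m. if w = v then \<Sum>c\<in>UNIV. \<Sum>s\<in>UNIV. ent Z u (v @ [c, s]) * M $ (c, s) $ p else 0)"
    using assms by (intro sum.cong refl) (auto simp: two_site_last)
  also have "\<dots> = (\<Sum>c\<in>UNIV. \<Sum>s\<in>UNIV. ent Z u (v @ [c, s]) * M $ (c, s) $ p)"
    using assms by (simp add: tens_def finite_tens[unfolded tens_def])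
  finally show ?thesis
    by (simp add: sum.cartesian_product split_def)
qed

text \<open>The coefficient of X^c_d in the entry (i, j) of Tr_q(2)(M X_1 N).\<close>

definition conj_coeff :: "'b::ring_1 ^'n::finite ^'n \<Rightarrow> 'b ^('n \<times> 'n) ^('n \<times> 'n) \<Rightarrow>
    'b ^('n \<times> 'n) ^('n \<times> 'n) \<Rightarrow> 'n \<Rightarrow> 'n \<Rightarrow> 'n \<Rightarrow> 'n \<Rightarrow> 'b"
  where "conj_coeff D M N i j c d =
    (\<Sum>s\<in>UNIV. \<Sum>b\<in>UNIV. \<Sum>b'\<in>UNIV. D $ b $ b' * M $ (i, b') $ (c, s) * N $ (d, s) $ (j, b))"

lemma ent_qtr_conj:
  fixes D :: "'b::ring_1 ^'n::finite ^'n"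
  assumes D: "\<And>a b x. D $ a $ b * x = x * D $ a $ b" and M: "\<And>a b x. M $ a $ b * x = x * M $ a $ b"
    and len: "length u = m" "length v = m"
  shows "ent (qtr D (site2 (Suc (Suc m)) M (Suc m) * lift X * site2 (Suc (Suc m)) N (Suc m)))
      (u @ [i]) (v @ [j])
    = (\<Sum>c\<in>UNIV. \<Sum>d\<in>UNIV. ent X (u @ [c]) (v @ [d]) * conj_coeff D M N i j c d)"
proof -
  have e: "ent (site2 (Suc (Suc m)) M (Suc m) * lift X * site2 (Suc (Suc m)) N (Suc m))
      (u @ [i, b']) (v @ [j, b])
    = (\<Sum>c\<in>UNIV. \<Sum>d\<in>UNIV. \<Sum>s\<in>UNIV. M $ (i, b') $ (c, s) * (ent X (u @ [c]) (v @ [d]) * N $ (d, s) $ (j, b)))"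
    for b b'
  proof -
    have "ent (lift X * site2 (Suc (Suc m)) N (Suc m)) (u @ [c, s]) (v @ [j, b])
        = (\<Sum>d\<in>UNIV. ent X (u @ [c]) (v @ [d]) * N $ (d, s) $ (j, b))" for c s
    proof -
      have l: "ent (lift X) (u @ [c, s]) (v @ [d, t]) = (if s = t then ent X (u @ [c]) (v @ [d]) else 0)" for d t
        using ent_lift(3)[of X "u @ [c]" s "v @ [d]" t] by simp
      have "ent (lift X * site2 (Suc (Suc m)) N (Suc m)) (u @ [c, s]) (v @ [j, b]) =
          (\<Sum>d\<in>UNIV. \<Sum>t\<in>UNIV. ent (lift X) (u @ [c, s]) (v @ [d, t]) * N $ (d, t) $ (j, b))"
        using site2_apply_right[of v m "u @ [c, s]" "lift X" N "(j, b)"] len by (simp add: sum_pair)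
      also have "\<dots> = (\<Sum>d\<in>UNIV. \<Sum>t\<in>UNIV. if s = t then ent X (u @ [c]) (v @ [d]) * N $ (d, s) $ (j, b) else 0)"
        by (intro sum.cong refl) (auto simp: l)
      finally show ?thesis by simp
    qed
    then have "ent (site2 (Suc (Suc m)) M (Suc m) * lift X * site2 (Suc (Suc m)) N (Suc m))
        (u @ [i, b']) (v @ [j, b])
      = (\<Sum>x\<in>UNIV. M $ (i, b') $ x * (\<Sum>d\<in>UNIV. ent X (u @ [fst x]) (v @ [d]) * N $ (d, snd x) $ (j, b)))"
      using site2_apply_left[OF len(1), of M "lift X * site2 (Suc (Suc m)) N (Suc m)" "(i, b')"]
      by (simp add: mult.assoc)
    also have "\<dots> = (\<Sum>c\<in>UNIV. \<Sum>s\<in>UNIV. \<Sum>d\<in>UNIV. M $ (i, b') $ (c, s) * (ent X (u @ [c]) (v @ [d]) * N $ (d, s) $ (j, b)))"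
      by (simp add: sum_distrib_left sum_pair)
    also have "\<dots> = (\<Sum>c\<in>UNIV. \<Sum>d\<in>UNIV. \<Sum>s\<in>UNIV. M $ (i, b') $ (c, s) * (ent X (u @ [c]) (v @ [d]) * N $ (d, s) $ (j, b)))"
      by (intro sum.cong refl sum.swap)
    finally show ?thesis .
  qed
  \<comment> \<open>Entries of \<open>D\<close> and \<open>M\<close> are central and can be
    collected; those of \<open>X\<close> and \<open>N\<close> keep their order.\<close>
  have move: "D $ b $ b' * (M $ p $ y * (x * z)) = x * (D $ b $ b' * M $ p $ y * z)" for b b' p y x z
    by (metis D M mult.assoc)
  have "ent (qtr D (site2 (Suc (Suc m)) M (Suc m) * lift X * site2 (Suc (Suc m)) N (Suc m)))
      (u @ [i]) (v @ [j])
    = (\<Sum>b\<in>UNIV. \<Sum>b'\<in>UNIV. \<Sum>c\<in>UNIV. \<Sum>d\<in>UNIV. \<Sum>s\<in>UNIV. ent X (u @ [c]) (v @ [d]) *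
        (D $ b $ b' * M $ (i, b') $ (c, s) * N $ (d, s) $ (j, b)))"
    by (simp add: ent_qtr e sum_distrib_left move)
  also have "\<dots> = (\<Sum>c\<in>UNIV. \<Sum>d\<in>UNIV. \<Sum>s\<in>UNIV. \<Sum>b\<in>UNIV. \<Sum>b'\<in>UNIV. ent X (u @ [c]) (v @ [d]) *
        (D $ b $ b' * M $ (i, b') $ (c, s) * N $ (d, s) $ (j, b)))"
    unfolding sum.cartesian_product
    by (rule sum.reindex_bij_witness[of _ "\<lambda>(c, d, s, b, b'). (b, b', c, d, s)" "\<lambda>(b, b', c, d, s). (c, d, s, b, b')"]) auto
  finally show ?thesis by (simp add: conj_coeff_def sum_distrib_left)
qed

text \<open>The matrix of D_1 D_2 on two copies.\<close>

definition mat_tensor_sq :: "'b::ring_1 ^'n::finite ^'n \<Rightarrow> 'b ^('n \<times> 'n) ^('n \<times> 'n)"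
  where "mat_tensor_sq D = (\<chi> p x. D $ fst p $ fst x * D $ snd p $ snd x)"

lemma ent_qtr_qtr:
  "ent (qtr D (qtr D Z)) u v = (\<Sum>p\<in>UNIV. \<Sum>x\<in>UNIV.
      mat_tensor_sq D $ p $ x * ent Z (u @ [fst x, snd x]) (v @ [fst p, snd p]))"
proof -
  have "ent (qtr D (qtr D Z)) u v = (\<Sum>a\<in>UNIV. \<Sum>b\<in>UNIV. \<Sum>a'\<in>UNIV. \<Sum>b'\<in>UNIV.
      D $ a $ b * D $ a' $ b' * ent Z (u @ [b, b']) (v @ [a, a']))"
    by (simp add: ent_qtr sum_distrib_left mult.assoc)
  also have "\<dots> = (\<Sum>a\<in>UNIV. \<Sum>a'\<in>UNIV. \<Sum>b\<in>UNIV. \<Sum>b'\<in>UNIV.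
      D $ a $ b * D $ a' $ b' * ent Z (u @ [b, b']) (v @ [a, a']))"
    by (intro sum.cong refl sum.swap)
  finally show ?thesis
    by (simp add: mat_tensor_sq_def sum_pair)
qed

text \<open>Centrality of the entries of \<open>M\<close> allows moving it around the ordinary trace
  over the last two copies, and \<open>comm\<close> takes it past D_1 D_2.\<close>

lemma qtr_qtr_cyclic:
  fixes D :: "'b::ring_1 ^'n::finite ^'n"
  assumes M: "\<And>a b x. M $ a $ b * x = x * M $ a $ b"
    and comm: "mat_tensor_sq D ** M = M ** mat_tensor_sq D"
    and Z: "homog (Suc (Suc m)) Z"
  shows "qtr D (qtr D (site2 (Suc (Suc m)) M (Suc m) * Z)) = qtr D (qtr D (Z * site2 (Suc (Suc m)) M (Suc m)))"
proof (rule gop_eqI)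
  fix u v :: "'n list" assume len: "length u = length v"
  let ?T = "mat_tensor_sq D"
  show "ent (qtr D (qtr D (site2 (Suc (Suc m)) M (Suc m) * Z))) u v =
      ent (qtr D (qtr D (Z * site2 (Suc (Suc m)) M (Suc m)))) u v"
  proof (cases "length u = m")
    case False
    moreover have "homog (Suc (Suc m)) (site2 (Suc (Suc m)) M (Suc m) * Z)"
      "homog (Suc (Suc m)) (Z * site2 (Suc (Suc m)) M (Suc m))"
      using Z by (auto intro: homog_mult homog_site2)
    ultimately show ?thesis by (simp add: ent_qtr_qtr homog_iff)
  next
    case True
    have "ent (qtr D (qtr D (site2 (Suc (Suc m)) M (Suc m) * Z))) u v =
      (\<Sum>p\<in>UNIV. \<Sum>x\<in>UNIV. \<Sum>y\<in>UNIV.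
         ?T $ p $ x * M $ x $ y * ent Z (u @ [fst y, snd y]) (v @ [fst p, snd p]))"
      by (simp add: ent_qtr_qtr site2_apply_left[OF True] sum_distrib_left mult.assoc)
    also have "\<dots> = (\<Sum>p\<in>UNIV. \<Sum>y\<in>UNIV. \<Sum>x\<in>UNIV.
         ?T $ p $ x * M $ x $ y * ent Z (u @ [fst y, snd y]) (v @ [fst p, snd p]))"
      by (intro sum.cong refl sum.swap)
    also have "\<dots> = (\<Sum>p\<in>UNIV. \<Sum>y\<in>UNIV. (?T ** M) $ p $ y * ent Z (u @ [fst y, snd y]) (v @ [fst p, snd p]))"
      by (simp add: matrix_matrix_mult_def sum_distrib_right)
    also have "\<dots> = (\<Sum>p\<in>UNIV. \<Sum>y\<in>UNIV. \<Sum>x\<in>UNIV.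
         M $ p $ x * ?T $ x $ y * ent Z (u @ [fst y, snd y]) (v @ [fst p, snd p]))"
      unfolding comm by (simp add: matrix_matrix_mult_def sum_distrib_right)
    also have "\<dots> = (\<Sum>x\<in>UNIV. \<Sum>y\<in>UNIV. \<Sum>p\<in>UNIV.
         M $ p $ x * ?T $ x $ y * ent Z (u @ [fst y, snd y]) (v @ [fst p, snd p]))"
      unfolding sum.cartesian_product
      by (rule sum.reindex_bij_witness[of _ "\<lambda>(p, y, x). (x, y, p)" "\<lambda>(p, y, x). (x, y, p)"]) auto
    also have "\<dots> = (\<Sum>x\<in>UNIV. \<Sum>y\<in>UNIV. \<Sum>p\<in>UNIV.
         ?T $ x $ y * (ent Z (u @ [fst y, snd y]) (v @ [fst p, snd p]) * M $ p $ x))"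
      by (simp add: M mult.assoc)
    also have "\<dots> = ent (qtr D (qtr D (Z * site2 (Suc (Suc m)) M (Suc m)))) u v"
      using True len by (simp add: ent_qtr_qtr site2_apply_right sum_distrib_left)
    finally show ?thesis .
  qed
qed

lemma ent_qtr_site2_last:
  "length u = m \<Longrightarrow> length v = m \<Longrightarrow> ent (qtr D (site2 (Suc (Suc m)) M (Suc m))) (u @ [i]) (v @ [j]) =
    (if u = v then \<Sum>a\<in>UNIV. \<Sum>b\<in>UNIV. D $ a $ b * M $ (i, b) $ (j, a) else 0)"
  by (simp add: ent_qtr ent_site2 two_site_last)

lemma homog_qtr: "homog (Suc m) Z \<Longrightarrow> homog m (qtr D Z)"
  by (simp add: homog_iff ent_qtr)

lemma homog_ext_snoc:
  assumes "homog (Suc m) X" "homog (Suc m) Y"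
    and "\<And>u v a b. length u = m \<Longrightarrow> length v = m \<Longrightarrow> ent X (u @ [a]) (v @ [b]) = ent Y (u @ [a]) (v @ [b])"
  shows "X = Y"
proof (rule homog_ext[OF assms(1,2)])
  fix u v :: "'a list" assume "length u = Suc m" "length v = Suc m"
  then show "ent X u v = ent Y u v"
    using assms(3) by (cases u rule: rev_cases; cases v rule: rev_cases) auto
qed

lemma D_equation_iff:
  fixes R :: "'a::field ^('n::finite \<times> 'n) ^('n \<times> 'n)"
  shows "ptrace 2 2 (tmul 2 (two_site 2 R 1) (one_site 2 K 2)) = tid 1 \<longleftrightarrow>
    (\<forall>i j. (\<Sum>a\<in>UNIV. \<Sum>b\<in>UNIV. R $ (i, a) $ (j, b) * K $ b $ a) = (if i = j then 1 else 0))"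
    (is "?Z = _ \<longleftrightarrow> _")
proof -
  have two: "two_site (Suc (Suc 0)) R (Suc 0) [i, a] [c, b] = R $ (i, a) $ (c, b)" for i a c b
    using two_site_last[of 0 R "[]" i a "[]" c b] by simp
  have one: "one_site (Suc (Suc 0)) K (Suc (Suc 0)) [c, b] [j, a] = (if c = j then K $ b $ a else 0)" for c b j a
    using one_site_last[of 1 K "[c]" b "[j]" a] by simp
  have e: "?Z [i] [j] = (\<Sum>a\<in>UNIV. \<Sum>b\<in>UNIV. R $ (i, a) $ (j, b) * K $ b $ a)" for i j
  proof -
    have "?Z [i] [j] = (\<Sum>a\<in>UNIV. \<Sum>c\<in>UNIV. \<Sum>b\<in>UNIV. R $ (i, a) $ (c, b) * (if c = j then K $ b $ a else 0))"
      by (simp add: ptrace_def tmul_def numeral_2_eq_2 sum_tens_Cons two one)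
         (simp add: tens_def)
    also have "\<dots> = (\<Sum>a\<in>UNIV. \<Sum>c\<in>UNIV. if c = j then \<Sum>b\<in>UNIV. R $ (i, a) $ (c, b) * K $ b $ a else 0)"
      by (intro sum.cong refl) auto
    finally show ?thesis by simp
  qed
  have "?Z u v = tid 1 u v" if "\<not> (length u = 1 \<and> length v = 1)" for u v
    using that by (auto simp: ptrace_def tid_def tens_def)
  then have "?Z = tid 1 \<longleftrightarrow> (\<forall>u v. length u = 1 \<and> length v = 1 \<longrightarrow> ?Z u v = tid 1 u v)"
    by (metis (no_types, lifting) ext)
  also have "\<dots> \<longleftrightarrow> (\<forall>i j. ?Z [i] [j] = tid 1 [i] [j])"
    by (auto simp: length_Suc_conv)
  finally show ?thesis unfolding e by (simp add: tid_def tens_def)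
qed

section \<open>Skew-invertibility and its consequences for \<open>D\<close>\<close>

lemma matrix_inv_both:
  assumes "invertible A"
  shows "A ** matrix_inv A = mat 1" "matrix_inv A ** A = mat 1"
  using someI_ex[OF assms[unfolded invertible_def]] unfolding matrix_inv_def by auto

locale skew_invertible_yb =
  fixes R :: "'a::field ^('n::finite \<times> 'n) ^('n \<times> 'n)" and D :: "'a ^'n ^'n"
  assumes YB: "yang_baxter R" and DM: "is_D_matrix R D"
begin

abbreviation "R' \<equiv> matrix_inv R"

lemma R_inv: "R ** R' = mat 1" "R' ** R = mat 1"
  using YB matrix_inv_both by (auto simp: yang_baxter_def)

lemma D_eq: "(\<Sum>a\<in>UNIV. \<Sum>b\<in>UNIV. R $ (i, a) $ (j, b) * D $ b $ a) = (if i = j then 1 else 0)"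
  using DM unfolding is_D_matrix_def D_equation_iff by blast

text \<open>A solution of the homogeneous system, added to \<open>D\<close>, would again solve the
  defining equation of \<open>D\<close>. Uniqueness of \<open>D\<close> therefore forces it to
  vanish.\<close>

lemma skew_inj:
  assumes "\<And>i j. (\<Sum>a\<in>UNIV. \<Sum>b\<in>UNIV. R $ (i, a) $ (j, b) * K b a) = 0"
  shows "K b a = 0"
proof -
  let ?D = "D + (\<chi> b a. K b a)"
  have "(\<Sum>a\<in>UNIV. \<Sum>b\<in>UNIV. R $ (i, a) $ (j, b) * ?D $ b $ a) = (if i = j then 1 else 0)" for i j
    by (simp add: distrib_left sum.distrib D_eq assms)
  then have "?D = D"
    using DM unfolding is_D_matrix_def D_equation_iff by blast
  then have "(\<chi> b a. K b a) $ b $ a = 0" by (metis add_cancel_right_right zero_index)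
  then show ?thesis by simp
qed

lemma site2_inv:
  assumes "1 \<le> i" "i < m"
  shows "site2 m R i * site2 m R' i = eu m" "site2 m R' i * site2 m R i = eu m"
  using assms by (simp_all add: site2_mult R_inv site2_mat_1)

lemma braid_3: "site2 3 R 1 * site2 3 R 2 * site2 3 R 1 = site2 3 R 2 * site2 3 R 1 * site2 3 R 2"
proof -
  have *: "Gop (tprod 3 [two_site 3 R i, two_site 3 R j, two_site 3 R k])
      = site2 3 R i * site2 3 R j * site2 3 R k" for i j k
    by (subst Gop_tprod[where m = 3])
      (auto intro: tsupp_two_site simp: site2_def[symmetric] mult.assoc homogD(2)[OF homog_site2])
  show ?thesis using YB by (simp add: yang_baxter_def flip: *)
qed

text \<open>The definition of \<open>D\<close> traces R D_2, the q-trace D_2 R; with entries in a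
  field the two partial traces coincide.\<close>

lemma qtr_R: "qtr D (site2 (Suc (Suc m)) R (Suc m)) = eu (Suc m)"
proof (rule homog_ext_snoc[OF homog_qtr[OF homog_site2] homog_eu])
  fix u v :: "'n list" and i j assume len: "length u = m" "length v = m"
  have "(\<Sum>a\<in>UNIV. \<Sum>b\<in>UNIV. D $ a $ b * R $ (i, b) $ (j, a)) = (\<Sum>b\<in>UNIV. \<Sum>a\<in>UNIV. R $ (i, b) $ (j, a) * D $ a $ b)"
    by (subst sum.swap) (simp add: mult.commute)
  then show "ent (qtr D (site2 (Suc (Suc m)) R (Suc m))) (u @ [i]) (v @ [j]) = ent (eu (Suc m) :: ('n, 'a) gop) (u @ [i]) (v @ [j])"
    using len by (cases "i = j") (simp_all add: ent_qtr_site2_last D_eq ent_eu)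
qed

text \<open>A conjugation in copies 2, 3 becomes one in copies 1, 2, to which the trace over copy 3
  is blind.\<close>

lemma braid_conj:
  "site2 3 R' 2 * site2 3 R 1 * site2 3 R 2 = site2 3 R 1 * site2 3 R 2 * site2 3 R' 1"
  "site2 3 R 2 * site2 3 R 1 * site2 3 R' 2 = site2 3 R' 1 * site2 3 R 2 * site2 3 R 1"
proof -
  let ?a = "site2 3 R 1" and ?b = "site2 3 R 2" and ?a' = "site2 3 R' 1" and ?b' = "site2 3 R' 2"
  have inv: "?a * ?a' = eu 3" "?a' * ?a = eu 3" "?b * ?b' = eu 3" "?b' * ?b = eu 3"
    by (auto intro!: site2_inv)
  have un: "eu 3 * site2 3 M i = site2 3 M i" "site2 3 M i * eu 3 = site2 3 M i" for M :: "'a ^('n \<times> 'n) ^('n \<times> 'n)" and i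
    using homogD[OF homog_site2] by auto
  have "?b' * ?a * ?b = ?b' * ?a * (?b * (?a * ?a'))" by (simp only: inv un)
  also have "\<dots> = ?b' * (?a * ?b * ?a) * ?a'" by (simp only: mult.assoc)
  also have "\<dots> = ?b' * (?b * ?a * ?b) * ?a'" by (simp only: braid_3)
  also have "\<dots> = ?b' * ?b * ?a * ?b * ?a'" by (simp only: mult.assoc)
  finally show "?b' * ?a * ?b = ?a * ?b * ?a'" by (simp only: inv un)
  have "?b * ?a * ?b' = ?a' * ?a * ?b * ?a * ?b'" by (simp only: inv un)
  also have "\<dots> = ?a' * (?a * ?b * ?a) * ?b'" by (simp only: mult.assoc)
  also have "\<dots> = ?a' * (?b * ?a * ?b) * ?b'" by (simp only: braid_3)
  also have "\<dots> = ?a' * ?b * ?a * (?b * ?b')" by (simp only: mult.assoc)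
  finally show "?b * ?a * ?b' = ?a' * ?b * ?a" by (simp only: inv un mult.assoc)
qed

text \<open>For \<open>(M, N) = (R, R\<^bsup>-1\<^esup>)\<close> and \<open>(R\<^bsup>-1\<^esup>, R)\<close>: the entries \<open>R\<^sup>i\<^sup>\<cdot>\<^sub>j\<^sub>\<cdot>\<close> span all matrices by \<open>skew_inj\<close>, so it suffices
  to evaluate both sides of \<open>Tr\<^sub>q\<^sub>(\<^sub>2\<^sub>)(M X\<^sub>1 N) = Tr\<^sub>q(X) I\<close> on them, where the Yang--Baxter equation applies.\<close>

lemma conj_coeff_D:
  assumes "qtr D (site2 3 M 2 * site2 3 R 1 * site2 3 N 2) = eu 2"
  shows "conj_coeff D M N i j c d = (if i = j then D $ d $ c else 0)"
proof -
  \<comment> \<open>The defect for fixed i and j, to be killed by \<open>skew_inj\<close>. The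
    operator R_1 in the assumption supplies the matrices X, one for each choice of its indices p, p'
    in copy 1.\<close>
  define K where "K d c = conj_coeff D M N i j c d - (if i = j then D $ d $ c else 0)" for c d
  have "(\<Sum>c\<in>UNIV. \<Sum>d\<in>UNIV. R $ (p, c) $ (p', d) * K d c) = 0" for p p'
  proof -
    have two: "two_site (Suc (Suc 0)) R (Suc 0) [i, a] [c, b] = R $ (i, a) $ (c, b)" for i a c b
      using two_site_last[of 0 R "[]" i a "[]" c b] by simp
    have "ent (eu 2 :: ('n, 'a) gop) [p, i] [p', j]
        = ent (qtr D (site2 (Suc (Suc 1)) M (Suc 1) * lift (site2 2 R 1) * site2 (Suc (Suc 1)) N (Suc 1))) ([p] @ [i]) ([p'] @ [j])"
      using assms by (simp add: lift_site2 numeral_3_eq_3 numeral_2_eq_2)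
    also have "\<dots> = (\<Sum>c\<in>UNIV. \<Sum>d\<in>UNIV. ent (site2 2 R 1) ([p] @ [c]) ([p'] @ [d]) * conj_coeff D M N i j c d)"
      by (rule ent_qtr_conj) (simp_all add: mult.commute)
    finally have "(\<Sum>c\<in>UNIV. \<Sum>d\<in>UNIV. R $ (p, c) $ (p', d) * conj_coeff D M N i j c d) = (if p = p' \<and> i = j then 1 else 0)"
      by (simp add: ent_site2 ent_eu numeral_2_eq_2 two)
    moreover have "(\<Sum>c\<in>UNIV. \<Sum>d\<in>UNIV. R $ (p, c) $ (p', d) * (if i = j then D $ d $ c else 0)) = (if p = p' \<and> i = j then 1 else 0)"
      by (cases "i = j") (simp_all add: D_eq)
    ultimately show ?thesis by (simp add: K_def right_diff_distrib sum_subtractf)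
  qed
  from skew_inj[of K, OF this] show ?thesis by (simp add: K_def)
qed

lemma qtr_lift_mult_lift: "qtr D (lift X * Z * lift Y) = X * qtr D Z * Y"
  by (simp add: qtr_mult_lift qtr_lift_mult mult.commute)

lemma lift_site2_2: "lift (site2 2 M 1) = site2 3 M 1"
  using lift_site2[of 1 2 M] by simp

text \<open>By \<open>braid_conj\<close> the operator under the trace is R_1 R_2 R_1^-1. Its outer
  factors leave the trace over copy 3, and the q-trace of R_2 is the identity.\<close>

lemma conj_coeff_inv_R: "conj_coeff D R' R i j c d = (if i = j then D $ d $ c else 0)"
proof (rule conj_coeff_D)
  have "qtr D (site2 3 R' 2 * site2 3 R 1 * site2 3 R 2) = qtr D (lift (site2 2 R 1) * site2 3 R 2 * lift (site2 2 R' 1))"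
    by (simp only: braid_conj lift_site2_2)
  also have "\<dots> = site2 2 R 1 * qtr D (site2 3 R 2) * site2 2 R' 1"
    by (rule qtr_lift_mult_lift)
  also have "\<dots> = eu 2"
    using qtr_R[of 1] site2_inv[of 1 2] homogD[OF homog_site2, of 2 R 1] by (simp add: numeral_3_eq_3 numeral_2_eq_2)
  finally show "qtr D (site2 3 R' 2 * site2 3 R 1 * site2 3 R 2) = eu 2" .
qed

lemma conj_coeff_R_inv: "conj_coeff D R R' i j c d = (if i = j then D $ d $ c else 0)"
proof (rule conj_coeff_D)
  have "qtr D (site2 3 R 2 * site2 3 R 1 * site2 3 R' 2) = qtr D (lift (site2 2 R' 1) * site2 3 R 2 * lift (site2 2 R 1))"
    by (simp only: braid_conj lift_site2_2)
  also have "\<dots> = site2 2 R' 1 * qtr D (site2 3 R 2) * site2 2 R 1"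
    by (rule qtr_lift_mult_lift)
  also have "\<dots> = eu 2"
    using qtr_R[of 1] site2_inv[of 1 2] homogD[OF homog_site2, of 2 R' 1] by (simp add: numeral_3_eq_3 numeral_2_eq_2)
  finally show "qtr D (site2 3 R 2 * site2 3 R 1 * site2 3 R' 2) = eu 2" .
qed

text \<open>It suffices to treat the inverse of \<open>R\<close>. By \<open>skew_inj\<close>, two
  matrices agree if their contractions with \<open>R\<close> do. On one side the contraction
  contains the coefficients of conjugation by the inverse of \<open>R\<close>, on the other side
  those of conjugation by \<open>R\<close>, and both evaluate to the same product of two entries of
  \<open>D\<close>.\<close>

lemma D_D_commute: "mat_tensor_sq D ** R = R ** mat_tensor_sq D"
proof -
  let ?T = "mat_tensor_sq D"
  have inv_comm: "?T ** R' = R' ** ?T"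
  proof -
    have "(?T ** R') $ (i, b) $ (c, s) - (R' ** ?T) $ (i, b) $ (c, s) = 0" for i b c s
    proof (rule skew_inj[of "\<lambda>b s. (?T ** R') $ (i, b) $ (c, s) - (R' ** ?T) $ (i, b) $ (c, s)"])
      fix d j
      have "(\<Sum>s\<in>UNIV. \<Sum>b\<in>UNIV. R $ (d, s) $ (j, b) * (?T ** R') $ (i, b) $ (c, s))
        = (\<Sum>s\<in>UNIV. \<Sum>b\<in>UNIV. \<Sum>k\<in>UNIV. \<Sum>b'\<in>UNIV. D $ i $ k * (D $ b $ b' * R' $ (k, b') $ (c, s) * R $ (d, s) $ (j, b)))"
        by (simp add: matrix_matrix_mult_def sum_pair mat_tensor_sq_def sum_distrib_left mult.commute mult.left_commute)
      also have "\<dots> = (\<Sum>k\<in>UNIV. \<Sum>s\<in>UNIV. \<Sum>b\<in>UNIV. \<Sum>b'\<in>UNIV. D $ i $ k * (D $ b $ b' * R' $ (k, b') $ (c, s) * R $ (d, s) $ (j, b)))"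
        unfolding sum.cartesian_product
        by (rule sum.reindex_bij_witness[of _ "\<lambda>(k, s, b, b'). (s, b, k, b')" "\<lambda>(s, b, k, b'). (k, s, b, b')"]) auto
      also have "\<dots> = (\<Sum>k\<in>UNIV. D $ i $ k * conj_coeff D R' R k j c d)"
        by (simp add: conj_coeff_def sum_distrib_left)
      also have "\<dots> = D $ i $ j * D $ d $ c"
        by (simp add: conj_coeff_inv_R if_distrib cong: if_cong)
      finally have 1: "(\<Sum>s\<in>UNIV. \<Sum>b\<in>UNIV. R $ (d, s) $ (j, b) * (?T ** R') $ (i, b) $ (c, s)) = D $ i $ j * D $ d $ c" .
      have "(\<Sum>s\<in>UNIV. \<Sum>b\<in>UNIV. R $ (d, s) $ (j, b) * (R' ** ?T) $ (i, b) $ (c, s))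
        = (\<Sum>s\<in>UNIV. \<Sum>b\<in>UNIV. \<Sum>k\<in>UNIV. \<Sum>t\<in>UNIV. D $ k $ c * (D $ t $ s * R $ (d, s) $ (j, b) * R' $ (i, b) $ (k, t)))"
        by (simp add: matrix_matrix_mult_def sum_pair mat_tensor_sq_def sum_distrib_left mult.commute mult.left_commute)
      also have "\<dots> = (\<Sum>k\<in>UNIV. \<Sum>b\<in>UNIV. \<Sum>t\<in>UNIV. \<Sum>s\<in>UNIV. D $ k $ c * (D $ t $ s * R $ (d, s) $ (j, b) * R' $ (i, b) $ (k, t)))"
        unfolding sum.cartesian_product
        by (rule sum.reindex_bij_witness[of _ "\<lambda>(k, b, t, s). (s, b, k, t)" "\<lambda>(s, b, k, t). (k, b, t, s)"]) auto
      also have "\<dots> = (\<Sum>k\<in>UNIV. D $ k $ c * conj_coeff D R R' d k j i)"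
        by (simp add: conj_coeff_def sum_distrib_left)
      also have "\<dots> = D $ i $ j * D $ d $ c"
        by (simp add: conj_coeff_R_inv if_distrib mult.commute cong: if_cong)
      finally have 2: "(\<Sum>s\<in>UNIV. \<Sum>b\<in>UNIV. R $ (d, s) $ (j, b) * (R' ** ?T) $ (i, b) $ (c, s)) = D $ i $ j * D $ d $ c" .
      show "(\<Sum>s\<in>UNIV. \<Sum>b\<in>UNIV. R $ (d, s) $ (j, b) * ((?T ** R') $ (i, b) $ (c, s) - (R' ** ?T) $ (i, b) $ (c, s))) = 0"
        by (simp add: right_diff_distrib sum_subtractf 1 2)
    qed
    then show ?thesis by (simp add: vec_eq_iff)
  qed
  have "?T ** R = R ** (R' ** ?T) ** R" by (simp add: matrix_mul_assoc R_inv)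
  also have "\<dots> = R ** ?T ** (R' ** R)" by (simp only: inv_comm[symmetric] matrix_mul_assoc)
  finally show ?thesis by (simp add: R_inv)
qed

end

section \<open>Powers of the q-trace and of the extension by the identity\<close>

lemma homog_mult_right: "homog m Y \<Longrightarrow> homog m (X * Y)"
  by (metis eu_central homog_def mult.assoc)

lemma qtr_pow_Suc: "(qtr D ^^ Suc p) Z = (qtr D ^^ p) (qtr D Z)"
  by (simp add: funpow_swap1)

lemma lift_pow_Suc: "(lift ^^ Suc p) Z = lift ((lift ^^ p) Z)"
  by simp

lemma homog_qtr_pow: "homog (m + p) Z \<Longrightarrow> homog m ((qtr D ^^ p) Z)"
proof (induction p arbitrary: Z)
  case (Suc p)
  then show ?case using homog_qtr[of "m + p" Z D] by (simp add: qtr_pow_Suc del: funpow.simps)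
qed simp

lemma qtr_pow_mult_lifts: "(qtr D ^^ p) (Z * (lift ^^ p) X) = (qtr D ^^ p) Z * X"
  by (induction p arbitrary: Z) (simp, simp only: qtr_pow_Suc lift_pow_Suc qtr_mult_lift)

lemma qtr_pow_lifts_mult:
  assumes "\<And>a b x. D $ a $ b * x = x * D $ a $ b"
  shows "(qtr D ^^ p) ((lift ^^ p) X * Z) = X * (qtr D ^^ p) Z"
  by (induction p arbitrary: Z) (simp, simp only: qtr_pow_Suc lift_pow_Suc qtr_lift_mult[OF assms])

lemma qtr_pow_diff: "(qtr D ^^ p) (X - Y) = (qtr D ^^ p) X - (qtr D ^^ p) Y"
  by (induction p) (simp_all add: qtr_diff)

section \<open>Iterated q-traces\<close>

text \<open>The ordinary trace is the q-trace of the identity matrix. Its powers connect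
  \<open>ptrace\<close>, a single sum over words, with traces taken copy by copy.\<close>

lemma ent_trace:
  fixes Z :: "('n::finite, 'b::ring_1) gop"
  shows "ent (qtr (mat 1) Z) u v = (\<Sum>a\<in>UNIV. ent Z (u @ [a]) (v @ [a]))"
  by (simp add: ent_qtr mat_def if_distrib if_distribR cong: if_cong)

lemma ent_trace_pow:
  fixes X :: "('n::finite, 'b::ring_1) gop"
  shows "ent ((qtr (mat 1) ^^ p) X) u v = (\<Sum>w\<in>tens p. ent X (u @ w) (v @ w))"
proof (induction p arbitrary: u v)
  case (Suc p)
  show ?case by (simp add: ent_trace Suc sum_tens_Cons)
qed simp

lemma trace_site1_last:
  fixes Z :: "('n::finite, 'b::ring_1) gop"
  assumes "homog (Suc m) Z"
  shows "qtr (mat 1) (site1 (Suc m) D (Suc m) * Z) = qtr D Z"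
proof (rule gop_eqI)
  fix u v :: "'n list" assume len: "length u = length v"
  show "ent (qtr (mat 1) (site1 (Suc m) D (Suc m) * Z)) u v = ent (qtr D Z) u v"
  proof (cases "length u = m")
    case True
    have "ent (site1 (Suc m) D (Suc m) * Z) (u @ [a]) (v @ [a])
        = (\<Sum>b\<in>UNIV. D $ a $ b * ent Z (u @ [b]) (v @ [a]))" for a
    proof -
      have "ent (site1 (Suc m) D (Suc m) * Z) (u @ [a]) (v @ [a])
          = (\<Sum>w\<in>tens m. if w = u then \<Sum>b\<in>UNIV. D $ a $ b * ent Z (u @ [b]) (v @ [a]) else 0)"
        unfolding ent_mult length_append_singleton sum_tens_snoc True
        by (intro sum.cong refl) (auto simp: ent_site1 one_site_last True)
      then show ?thesis using True by (simp add: tens_def finite_tens[unfolded tens_def])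
    qed
    then show ?thesis unfolding ent_trace by (simp add: ent_qtr)
  next
    case False
    then have "length (u @ [b]) \<noteq> Suc m" for b by simp
    then show ?thesis using assms homog_mult_right[OF assms, of "site1 (Suc m) D (Suc m)"]
      by (simp add: ent_qtr homog_iff)
  qed
qed

lemma lift_prod_site1:
  "\<forall>i\<in>set xs. 1 \<le> i \<and> i \<le> m \<Longrightarrow>
    lift (prod_list (map (site1 m M) xs) * eu m) = prod_list (map (site1 (Suc m) M) xs) * eu (Suc m)"
  by (induction xs) (simp_all add: lift_eu mult.assoc lift_mult lift_site1)

text \<open>The first trace, over the last copy, absorbs the factor \<open>D\<close> acting there.
  The remaining factors are lifts, so they leave this trace, and the induction continues with one
  copy fewer.\<close>

lemma trace_pow_prod_site1:
  "p \<le> m \<Longrightarrow> homog m Z \<Longrightarrow>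
    (qtr (mat 1) ^^ p) (prod_list (map (site1 m D) [Suc m - p..<Suc m]) * eu m * Z) = (qtr D ^^ p) Z"
proof (induction p arbitrary: m Z)
  case 0
  then show ?case by (simp add: homogD)
next
  case (Suc p)
  then obtain n where m: "m = Suc n" by (cases m) auto
  have ups: "[Suc m - Suc p..<Suc m] = [Suc n - p..<Suc n] @ [m]"
    using Suc.prems by (simp add: m)
  have "prod_list (map (site1 m D) [Suc m - Suc p..<Suc m]) * eu m * Z
      = prod_list (map (site1 m D) [Suc n - p..<Suc n]) * (eu m * site1 m D m * Z)"
    unfolding ups using Suc.prems by (simp add: mult.assoc homogD homogD[OF homog_site1] mult.assoc[symmetric, of "eu m"])
  also have "\<dots> = lift (prod_list (map (site1 n D) [Suc n - p..<Suc n]) * eu n) * (site1 m D m * Z)"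
    using Suc.prems m by (subst lift_prod_site1) (auto simp: mult.assoc)
  finally have "qtr (mat 1) (prod_list (map (site1 m D) [Suc m - Suc p..<Suc m]) * eu m * Z)
      = prod_list (map (site1 n D) [Suc n - p..<Suc n]) * eu n * qtr (mat 1) (site1 m D m * Z)"
    by (simp add: qtr_lift_mult mat_def)
  also have "qtr (mat 1) (site1 m D m * Z) = qtr D Z"
    using trace_site1_last Suc.prems m by blast
  finally have "qtr (mat 1) (prod_list (map (site1 m D) [Suc m - Suc p..<Suc m]) * eu m * Z)
      = prod_list (map (site1 n D) [Suc n - p..<Suc n]) * eu n * qtr D Z" .
  moreover have "p \<le> n" "homog n (qtr D Z)" using Suc.prems m homog_qtr by auto
  ultimately show ?case using Suc.IH[of n "qtr D Z"] by (simp only: qtr_pow_Suc)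
qed

lemma Gop_qtrace:
  fixes Z :: "('n::finite, 'b::ring_1) tensor_op"
  assumes "tsupp m Z" "1 \<le> a" "a \<le> Suc m"
  shows "Gop (qtrace D m a Z) = (qtr D ^^ (Suc m - a)) (Gop Z)"
proof -
  let ?P = "tprod m (map (one_site m D) [a..<m + 1])"
  have P: "tsupp m ?P" by (rule tsupp_tprod) (auto intro: tsupp_one_site)
  have "Gop ?P = prod_list (map (site1 m D) [a..<m + 1]) * eu m"
    by (subst Gop_tprod) (auto intro: tsupp_one_site simp: comp_def site1_def[symmetric])
  then have PZ: "Gop (tmul m ?P Z) = prod_list (map (site1 m D) [Suc m - (Suc m - a)..<Suc m]) * eu m * Gop Z"
    using Gop_tmul[OF P] assms by simp
  have s: "tsupp m (tmul m ?P Z)" by (rule tsupp_tmul[OF P assms(1)])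
  have "Gop (qtrace D m a Z) = (qtr (mat 1) ^^ (Suc m - a)) (Gop (tmul m ?P Z))"
  proof (rule gop_eqI)
    fix u v :: "'n list" assume len: "length u = length v"
    show "ent (Gop (qtrace D m a Z)) u v = ent ((qtr (mat 1) ^^ (Suc m - a)) (Gop (tmul m ?P Z))) u v"
    proof (cases "length u = a - 1")
      case True
      then show ?thesis using len
        by (simp add: qtrace_def ptrace_def ent_Gop ent_trace_pow tens_def)
    next
      case False
      then have "\<And>w. w \<in> tens (Suc m - a) \<Longrightarrow> length (u @ w) \<noteq> m" using assms by (auto simp: tens_def)
      then have "\<And>w. w \<in> tens (Suc m - a) \<Longrightarrow> tmul m ?P Z (u @ w) (v @ w) = 0"
        using s by (auto simp: tsupp_def)
      then show ?thesis using False len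
        by (simp add: qtrace_def ptrace_def ent_Gop ent_trace_pow tens_def)
    qed
  qed
  also have "\<dots> = (qtr D ^^ (Suc m - a)) (Gop Z)"
    unfolding PZ by (rule trace_pow_prod_site1) (use assms homog_Gop in auto)
  finally show ?thesis .
qed

section \<open>Supports and images of the remaining basic operations\<close>

lemma tsupp_tscale: "tsupp m X \<Longrightarrow> tsupp m (tscale c X)"
  by (simp add: tsupp_def tscale_def)

lemma tsupp_tdiff: "tsupp m X \<Longrightarrow> tsupp m Y \<Longrightarrow> tsupp m (tdiff X Y)"
  by (simp add: tsupp_def tdiff_def)

lemma Gop_tscale: "Gop (tscale c X) = smul c (Gop X)"
  by (rule gop_eqI) (simp add: ent_Gop tscale_def)

lemma Gop_tdiff: "Gop (tdiff X Y) = Gop X - Gop Y"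
  by (rule gop_eqI) (simp add: ent_Gop tdiff_def)

lemma tsupp_antisym: "tsupp m (antisym q R m k)"
  by (induction q R m k rule: antisym.induct)
    (auto intro!: tsupp_tid tsupp_tscale tsupp_tprod tsupp_tdiff tsupp_two_site)

lemma tsupp_L_bar: "tsupp m (L_bar emb R L m k)"
  by (induction emb R L m k rule: L_bar.induct)
    (auto intro!: tsupp_tid tsupp_tprod tsupp_two_site tsupp_one_site)

section \<open>Cayley--Hamilton--Newton identities\<close>

locale rlrl_setup = skew_invertible_yb R D + coeff_map emb
  for R :: "'a::field ^('n::finite \<times> 'n) ^('n \<times> 'n)" and D :: "'a ^'n ^'n"
    and emb :: "'a \<Rightarrow> 'b::ring_1" +
  fixes q :: 'a and L :: "'b ^'n ^'n"
  assumes hecke: "hecke_type q R" and q_nz: "q \<noteq> 0" and q_root: "\<not> root_of_unity q"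
    and rlrl: "rlrl_diff emb R L u v = 0"
begin

definition "Rb = map_matrix emb R"
definition "Ri = map_matrix emb R'"
definition "Db = map_matrix emb D"

abbreviation "r m \<equiv> site2 m Rb"
abbreviation "r' m \<equiv> site2 m Ri"
abbreviation "l m \<equiv> site1 m L (Suc 0)"
abbreviation "E \<equiv> qtr Db"

lemma central: "Rb $ a $ b * x = x * Rb $ a $ b" "Ri $ a $ b * x = x * Ri $ a $ b" "Db $ c $ d * x = x * Db $ c $ d"
  by (simp_all add: Rb_def Ri_def Db_def map_matrix_def emb_central)

lemma E_gmap: "E (gmap emb Z) = gmap emb (qtr D Z)"
  by (rule gop_eqI) (simp add: ent_qtr Db_def map_matrix_def emb_sum emb_mult)

lemma E_r: "E (r (Suc (Suc m)) (Suc m)) = eu (Suc m)"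
  using E_gmap[of "site2 (Suc (Suc m)) R (Suc m)"] by (simp add: qtr_R gmap_site2 gmap_eu Rb_def)

text \<open>The coefficients of this map involve only \<open>R\<close>, its inverse and
  \<open>D\<close>, hence are images under \<open>emb\<close> of those in
  \<open>conj_coeff_inv_R\<close>; the entries of \<open>X\<close> may be noncommutative.\<close>

lemma E_conj:
  assumes "homog (Suc m) X"
  shows "E (r' (Suc (Suc m)) (Suc m) * lift X * r (Suc (Suc m)) (Suc m)) = lift (E X)"
proof (rule homog_ext_snoc)
  show "homog (Suc m) (E (r' (Suc (Suc m)) (Suc m) * lift X * r (Suc (Suc m)) (Suc m)))"
    by (intro homog_qtr homog_mult homog_site2)
  show "homog (Suc m) (lift (E X))" by (intro homog_lift homog_qtr assms)
  fix u v :: "'n list" and i j assume len: "length u = m" "length v = m"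
  have c: "conj_coeff Db Ri Rb i j c d = (if i = j then Db $ d $ c else 0)" for c d
  proof -
    have "conj_coeff Db Ri Rb i j c d = emb (conj_coeff D R' R i j c d)"
      by (simp add: conj_coeff_def Db_def Ri_def Rb_def map_matrix_def emb_sum emb_mult)
    then show ?thesis by (simp add: conj_coeff_inv_R Db_def map_matrix_def)
  qed
  have "ent (E (r' (Suc (Suc m)) (Suc m) * lift X * r (Suc (Suc m)) (Suc m))) (u @ [i]) (v @ [j])
      = (\<Sum>c\<in>UNIV. \<Sum>d\<in>UNIV. ent X (u @ [c]) (v @ [d]) * (if i = j then Db $ d $ c else 0))"
    using ent_qtr_conj[of Db Ri u m v X Rb i j] central len by (simp add: c)
  also have "\<dots> = (if i = j then \<Sum>c\<in>UNIV. \<Sum>d\<in>UNIV. Db $ d $ c * ent X (u @ [c]) (v @ [d]) else 0)"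
    by (simp add: central)
  also have "\<dots> = ent (lift (E X)) (u @ [i]) (v @ [j])"
    using sum.swap[of "\<lambda>c d. Db $ d $ c * ent X (u @ [c]) (v @ [d])" UNIV UNIV] by (simp add: ent_qtr)
  finally show "ent (E (r' (Suc (Suc m)) (Suc m) * lift X * r (Suc (Suc m)) (Suc m))) (u @ [i]) (v @ [j])
      = ent (lift (E X)) (u @ [i]) (v @ [j])" .
qed

lemma E_E_cyclic:
  assumes "homog (Suc (Suc m)) Z"
  shows "E (E (r (Suc (Suc m)) (Suc m) * Z)) = E (E (Z * r (Suc (Suc m)) (Suc m)))"
proof (rule qtr_qtr_cyclic[OF central(1) _ assms])
  have "map_matrix emb (mat_tensor_sq D) = mat_tensor_sq Db"
    by (simp add: mat_tensor_sq_def Db_def map_matrix_def vec_eq_iff emb_mult)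
  then show "mat_tensor_sq Db ** Rb = Rb ** mat_tensor_sq Db"
    using arg_cong[OF D_D_commute, of "map_matrix emb"] by (simp add: map_matrix_mult Rb_def)
qed

section \<open>Hecke, braid and reflection relations over the algebra\<close>

lemma r_inv:
  assumes "1 \<le> i" "i < m"
  shows "r m i * r' m i = eu m" "r' m i * r m i = eu m"
  using arg_cong[OF site2_inv(1)[OF assms], of "gmap emb"] arg_cong[OF site2_inv(2)[OF assms], of "gmap emb"]
  by (simp_all add: gmap_mult gmap_site2 gmap_eu Rb_def Ri_def)

lemma r_hecke:
  assumes "1 \<le> i" "i < m"
  shows "r m i * r m i = eu m + smul (emb (q - inverse q)) (r m i)"
proof -
  obtain S A where SA: "S ** S = S" "A ** A = A" "S ** A = 0" "A ** S = 0" "S + A = mat 1"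
    "R = mat_scale q S - mat_scale (inverse q) A"
    using hecke unfolding hecke_type_def by blast
  have sc: "mat_scale a M ** mat_scale b N = mat_scale (a * b) (M ** N)" for a b :: 'a and M N :: "'a ^('n \<times> 'n) ^('n \<times> 'n)"
    by (simp add: mat_scale_def matrix_matrix_mult_def vec_eq_iff sum_distrib_left algebra_simps)
  have dist: "(M - N) ** K = M ** K - N ** K" "K ** (M - N) = K ** M - K ** N" for K M N :: "'a ^('n \<times> 'n) ^('n \<times> 'n)"
    by (simp_all add: matrix_matrix_mult_def vec_eq_iff sum_subtractf algebra_simps)
  have z: "mat_scale a 0 = (0 :: 'a ^('n \<times> 'n) ^('n \<times> 'n))" for a
    by (simp add: mat_scale_def vec_eq_iff)
  have "R ** R = mat_scale (q * q) S + mat_scale (inverse q * inverse q) A"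
    unfolding SA(6) dist sc SA(1-4) z by simp
  also have "\<dots> = (S + A) + mat_scale (q - inverse q) R"
  proof -
    have c: "q * (inverse q * x) = x" for x using q_nz by (simp flip: mult.assoc)
    show ?thesis by (simp add: c SA(6) mat_scale_def vec_eq_iff algebra_simps)
  qed
  finally have "R ** R = mat 1 + mat_scale (q - inverse q) R" using SA(5) by simp
  then have "site2 m R i * site2 m R i = eu m + smul (q - inverse q) (site2 m R i)"
    by (simp add: site2_mult[OF assms] site2_add site2_scale site2_mat_1[OF assms])
  from arg_cong[OF this, of "gmap emb"] show ?thesis
    by (simp add: gmap_mult gmap_add gmap_smul gmap_site2 gmap_eu Rb_def)
qed

lemma r_braid:
  assumes "1 \<le> i" "Suc i < m"
  shows "r m i * r m (Suc i) * r m i = r m (Suc i) * r m i * r m (Suc i)"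
proof -
  have 3: "r 3 1 * r 3 2 * r 3 1 = r 3 2 * r 3 1 * r 3 2"
    using arg_cong[OF braid_3, of "gmap emb"] by (simp only: gmap_mult gmap_site2 Rb_def)
  let ?t = "\<lambda>X. (lift ^^ (m - i - 2)) ((rlift ^^ (i - 1)) X)"
  have e: "1 + (i - 1) = i" "2 + (i - 1) = Suc i" using assms by auto
  have t: "?t (r 3 1) = r m i" "?t (r 3 2) = r m (Suc i)"
    using site2_transport[of 1 3 "i - 1" "m - i - 2" m Rb] site2_transport[of 2 3 "i - 1" "m - i - 2" m Rb]
    unfolding e using assms by auto
  from arg_cong[OF 3, of ?t] show ?thesis by (simp only: t lifts_mult rlifts_mult)
qed

lemma l_reflection:
  assumes "1 < m"
  shows "r m 1 * l m * r m 1 * l m = l m * r m 1 * l m * r m 1"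
proof -
  have G: "Gop (tprod 2 [X, Y, X, Y]) = Gop X * Gop Y * Gop X * Gop Y"
    if "tsupp 2 X" "tsupp 2 Y" for X Y :: "('n, 'b) tensor_op"
    using that by (subst Gop_tprod[where m = 2]) (auto simp: mult.assoc homogD(2) homog_Gop)
  have "tprod 2 [two_site 2 Rb 1, one_site 2 L 1, two_site 2 Rb 1, one_site 2 L 1] =
      tprod 2 [one_site 2 L 1, two_site 2 Rb 1, one_site 2 L 1, two_site 2 Rb 1]"
    using rlrl unfolding rlrl_diff_def Let_def tdiff_def Rb_def by (intro ext) simp
  from arg_cong[OF this, of Gop] have 2: "r 2 1 * l 2 * r 2 1 * l 2 = l 2 * r 2 1 * l 2 * r 2 1"
    by (simp only: G tsupp_two_site tsupp_one_site site2_def site1_def One_nat_def)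
  have e: "2 + (m - 2) = m" using assms by simp
  have t: "(lift ^^ (m - 2)) (r 2 1) = r m 1" "(lift ^^ (m - 2)) (l 2) = l m"
    using lifts_site2[of 1 2 "m - 2" Rb] lifts_site1[of 1 2 "m - 2" L] unfolding e by auto
  from arg_cong[OF 2, of "lift ^^ (m - 2)"] show ?thesis by (simp only: lifts_mult t)
qed

text \<open>One instance for every number m of copies, since lifts and traces change m.\<close>

sublocale refl: reflection_rep "eu m" "l m" "r m" "r' m" m for m
proof
  show "1 < m \<Longrightarrow> r m 1 * l m * r m 1 * l m = l m * r m 1 * l m * r m 1" by (rule l_reflection)
  show "1 < i \<Longrightarrow> i < m \<Longrightarrow> r m i * l m = l m * r m i" for i
    by (rule site1_far[symmetric, unfolded One_nat_def]) (auto intro: central)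
  show "1 \<le> i \<Longrightarrow> Suc i < j \<Longrightarrow> j < m \<Longrightarrow> r m i * r m j = r m j * r m i" for i j
    by (rule site2_far) (auto intro: central)
qed (auto simp: homogD[OF homog_site1] homogD[OF homog_site2] r_inv r_braid)

sublocale alg: scalar_algebra "\<lambda>a. smul (emb a)" q "eu m" for m
  by (rule gop_scalar_algebra[OF q_nz q_root])

lemma r_hecke_gens: "alg.hecke_gens m (r m) m"
  unfolding alg.hecke_gens_def
  by (auto simp: r_hecke r_braid intro: refl.far)

lemma homog_hasym: "homog m (alg.hasym m s k)"
  by (simp add: homog_def)

lemma lift_ell: "k < m \<Longrightarrow> lift (refl.ell m k) = refl.ell (Suc m) k"
  by (induction k) (simp_all add: lift_mult lift_site1 lift_site2)

lemma lift_Lam: "k \<le> m \<Longrightarrow> lift (refl.Lam m k) = refl.Lam (Suc m) k"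
  by (induction k) (simp_all add: lift_mult lift_ell lift_eu)

lemma lift_cox: "k < m \<Longrightarrow> lift (refl.cox m k) = refl.cox (Suc m) k"
  by (induction k) (simp_all add: lift_mult lift_site2 lift_eu)

lemma lift_cox_inv: "k < m \<Longrightarrow> lift (refl.cox_inv m k) = refl.cox_inv (Suc m) k"
  by (induction k) (simp_all add: lift_mult lift_site2 lift_eu)

lemma lift_hasym: "k \<le> m \<Longrightarrow> lift (alg.hasym m (r m) k) = alg.hasym (Suc m) (r (Suc m)) k"
proof (induction k)
  case (Suc k)
  then show ?case
    by (cases k) (simp_all add: lift_mult lift_site2 lift_eu lift_diff lift_smul
      del: alg.scale_mult_left alg.scale_mult_right)
qed (simp add: lift_eu)

lemma E_lift_mult: "E (lift X * Z) = X * E Z"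
  by (rule qtr_lift_mult) (rule central)

lemma E_pow_smul: "(E ^^ p) (smul (emb a) X) = smul (emb a) ((E ^^ p) X)"
proof -
  have c: "x * (emb a * y) = emb a * (x * y)" for x y
    by (metis emb_central mult.assoc)
  have "E (smul (emb a) X) = smul (emb a) (E X)" for X
    by (rule gop_eqI) (simp add: ent_qtr c sum_distrib_left)
  then show ?thesis by (induction p) simp_all
qed

text \<open>The trace over the last copy removes, by \<open>E_conj\<close>, the innermost
  conjugation and leaves the lift of \<open>E Y\<close>, conjugated by the next shorter
  \<open>cox\<close>. After all traces a multiple of the identity in copy 1 remains.\<close>

lemma E_pow_conj:
  "homog j Y \<Longrightarrow> (E ^^ j) (refl.cox (Suc j) j * lift Y * refl.cox_inv (Suc j) j) = lift ((E ^^ j) Y)"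
proof (induction j arbitrary: Y)
  case 0
  then show ?case using homogD[OF homog_lift[OF 0]] by simp
next
  case (Suc n)
  let ?m = "Suc (Suc n)"
  have "E (refl.cox ?m (Suc n) * lift Y * refl.cox_inv ?m (Suc n))
      = E (lift (refl.cox (Suc n) n) * (r' ?m (Suc n) * lift Y * r ?m (Suc n)) * lift (refl.cox_inv (Suc n) n))"
    by (simp add: lift_cox lift_cox_inv mult.assoc)
  also have "\<dots> = refl.cox (Suc n) n * lift (E Y) * refl.cox_inv (Suc n) n"
    by (simp only: qtr_mult_lift E_lift_mult E_conj[OF Suc.prems])
  finally show ?case
    unfolding qtr_pow_Suc using Suc.IH[OF homog_qtr[OF Suc.prems]] by simp
qed

text \<open>The traces are peeled off as before until two copies are left. There \<open>r 1\<close>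
  cancels the only factor of \<open>cox\<close>, and the rest is Tr_q(2)(Y_1 R_1) = Y by the
  definition of \<open>D\<close>.\<close>

lemma E_pow_r_conj:
  "homog (Suc n) Y \<Longrightarrow>
    (E ^^ Suc n) (r (Suc (Suc n)) 1 * refl.cox (Suc (Suc n)) (Suc n) * lift Y * refl.cox_inv (Suc (Suc n)) (Suc n))
      = (E ^^ n) Y"
proof (induction n arbitrary: Y)
  case 0
  have "r 2 1 * refl.cox 2 1 * lift Y * refl.cox_inv 2 1 = eu 2 * lift Y * r 2 1"
    using r_inv[of 1 2] by (simp add: mult.assoc[symmetric])
  also have "\<dots> = lift Y * r 2 1"
    using homogD(1)[OF homog_lift[OF 0]] by (simp add: numeral_2_eq_2)
  also have "E \<dots> = Y * E (r 2 1)" by (rule E_lift_mult)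
  also have "\<dots> = Y" using E_r[of 0] homogD(2)[OF 0] by (simp add: numeral_2_eq_2)
  finally show ?case by (simp add: numeral_2_eq_2)
next
  case (Suc n)
  let ?m = "Suc (Suc n)"
  have "E (r (Suc ?m) 1 * refl.cox (Suc ?m) ?m * lift Y * refl.cox_inv (Suc ?m) ?m)
      = E (lift (r ?m 1 * refl.cox ?m (Suc n)) * (r' (Suc ?m) ?m * lift Y * r (Suc ?m) ?m)
          * lift (refl.cox_inv ?m (Suc n)))"
    by (simp add: lift_mult lift_site2 lift_cox lift_cox_inv mult.assoc del: refl.cox.simps refl.cox_inv.simps)
       (simp add: mult.assoc)
  also have "\<dots> = r ?m 1 * refl.cox ?m (Suc n) * lift (E Y) * refl.cox_inv ?m (Suc n)"
    by (simp only: qtr_mult_lift E_lift_mult E_conj[OF Suc.prems])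
  finally show ?case
    using Suc.IH[OF homog_qtr[OF Suc.prems], of Db] by (simp only: qtr_pow_Suc)
qed

text \<open>The traces run over the copies 2, ..., j + 1, while copy 1 stays free. Generators in the
  traced copies have this property, see \<open>cyclic_r\<close>.\<close>

definition cyclic :: "nat \<Rightarrow> ('n, 'b) gop \<Rightarrow> bool"
  where "cyclic j X \<longleftrightarrow> (\<forall>Z. homog (Suc j) Z \<longrightarrow> (E ^^ j) (X * Z) = (E ^^ j) (Z * X))"

lemma cyclic_mult:
  assumes "cyclic j X" "cyclic j Y"
  shows "cyclic j (X * Y)"
  unfolding cyclic_def
proof (intro allI impI)
  fix Z :: "('n, 'b) gop" assume Z: "homog (Suc j) Z"
  have "(E ^^ j) (X * (Y * Z)) = (E ^^ j) (Y * (Z * X))"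
    using assms(1) homog_mult_right[OF Z] by (simp add: cyclic_def mult.assoc)
  also have "\<dots> = (E ^^ j) (Z * X * Y)"
    using assms(2) homog_mult[OF Z] by (simp add: cyclic_def)
  finally show "(E ^^ j) (X * Y * Z) = (E ^^ j) (Z * (X * Y))" by (simp add: mult.assoc)
qed

lemma cyclic_r:
  assumes "2 \<le> i" "i \<le> j"
  shows "cyclic j (r (Suc j) i)"
  unfolding cyclic_def
proof (intro allI impI)
  fix Z :: "('n, 'b) gop" assume Z: "homog (Suc j) Z"
  \<comment> \<open>The p copies behind copy i + 1 are traced first and do not involve the
    generator. Then come the two copies i, i + 1 on which it acts, and finally the m = i - 2
    remaining ones.\<close>
  define p where "p = j - i"
  obtain m where i: "i = Suc (Suc m)" using assms by (metis Suc_le_D numeral_2_eq_2 Suc_le_mono)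
  have j: "j = m + (2 + p)" using assms by (simp add: p_def i)
  have r: "r (Suc j) i = (lift ^^ p) (r (Suc i) i)"
    using lifts_site2[of i "Suc i" p Rb] assms by (simp add: p_def)
  have "homog (Suc i) ((E ^^ p) Z)"
    using Z by (intro homog_qtr_pow) (simp add: j i add.commute)
  then have "E (E (r (Suc i) i * (E ^^ p) Z)) = E (E ((E ^^ p) Z * r (Suc i) i))"
    using E_E_cyclic[of "Suc m"] i by simp
  then have "(E ^^ m) ((E ^^ 2) (r (Suc i) i * (E ^^ p) Z)) = (E ^^ m) ((E ^^ 2) ((E ^^ p) Z * r (Suc i) i))"
    by (simp add: numeral_2_eq_2)
  then show "(E ^^ j) (r (Suc j) i * Z) = (E ^^ j) (Z * r (Suc j) i)"
    unfolding r unfolding j funpow_add comp_apply qtr_pow_mult_lifts qtr_pow_lifts_mult[OF central(3)] .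
qed

lemma cyclic_hasym:
  "(\<And>i. 1 \<le> i \<Longrightarrow> i < k \<Longrightarrow> cyclic j (s i)) \<Longrightarrow> cyclic j (alg.hasym (Suc j) s k)"
proof (induction s k rule: alg.hasym.induct)
  case (3 s k)
  have sm: "cyclic j (smul (emb a) X)" if "cyclic j X" for a X
    using that by (simp add: cyclic_def E_pow_smul)
  have di: "cyclic j (X - Y)" if "cyclic j X" "cyclic j Y" for X Y
    using that by (simp add: cyclic_def left_diff_distrib right_diff_distrib qtr_pow_diff)
  have eu: "cyclic j (eu (Suc j))" by (simp add: cyclic_def eu_central)
  show ?case unfolding alg.hasym.simps by (intro sm cyclic_mult di eu 3) auto
qed (auto simp: cyclic_def eu_central)

section \<open>The Newton recursion\<close>

definition AL :: "nat \<Rightarrow> ('n, 'b) gop"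
  where "AL k = alg.hasym k (r k) k * refl.Lam k k"

lemma homog_AL: "homog k (AL k)"
  unfolding AL_def by (intro homog_mult homog_hasym)

lemma newton_recursion:
  assumes "1 \<le> j"
  shows "smul (emb (qnum q (Suc j))) ((E ^^ j) (AL (Suc j))) =
    smul (emb (q ^ j)) (lift ((E ^^ j) (AL j)) * l 1)
      - smul (emb (qnum q j)) ((E ^^ (j - 1)) (AL j) * l 1)"
proof -
  obtain n where n: "j = Suc n" using assms by (cases j) auto
  define k where "k = Suc j"
  define B where "B = alg.hasym k (\<lambda>i. r k (Suc i)) j"
  define C C' where "C = refl.cox k j" and "C' = refl.cox_inv k j"
  let ?L = "refl.Lam k k"
  have CC: "C' * C = eu k" "C * C' = eu k"
    using refl.cox_cox_inv[of j k] by (simp_all add: C_def C'_def k_def)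
  have BC: "B * C = C * lift (alg.hasym j (r j) j)"
    unfolding B_def C_def lift_hasym[OF order_refl] k_def
    by (rule alg.hasym_intertwine[symmetric]) (auto simp: refl.cox_conj)
  have BL: "B * ?L = C * lift (AL j) * C' * l k"
  proof -
    have "B * ?L = B * (C * refl.Lam k j * C' * l k)"
      using refl.Lam_Suc_conj[of j k] by (simp add: k_def C_def C'_def)
    also have "\<dots> = (B * C) * refl.Lam k j * C' * l k" by (simp only: mult.assoc)
    also have "\<dots> = C * lift (AL j) * C' * l k"
      by (simp only: BC AL_def lift_mult lift_Lam[OF order_refl] k_def mult.assoc)
    finally show ?thesis .
  qed
  have BB: "B * B = B"
  proof -
    have "alg.hecke_gens k (\<lambda>i. r k (Suc i)) j"
      using alg.hecke_gens_shift[of k "r k" j] r_hecke_gens[of k] by (simp add: k_def)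
    then show ?thesis unfolding B_def by (rule alg.hasym_idem)
  qed
  have BLcomm: "B * ?L = ?L * B"
    unfolding B_def
  proof (rule alg.hasym_intertwine[symmetric])
    show "?L * eu k = eu k * ?L" by (rule eu_central)
    show "?L * r k (Suc i) = r k (Suc i) * ?L" if "1 \<le> i" "i < j" for i
      by (rule refl.Lam_commute[symmetric]) (use that in \<open>auto simp: k_def\<close>)
  qed
  have cyc: "cyclic j B"
    unfolding B_def k_def by (rule cyclic_hasym) (auto intro: cyclic_r)
  \<comment> \<open>The untraced copy 1 is the only one in which \<open>l k\<close> acts, so it
    leaves the traces on the right.\<close>
  have lk: "l k = (lift ^^ j) (l 1)"
    using lifts_site1[of 1 1 j L] by (simp add: k_def)
  have 1: "(E ^^ j) (B * ?L) = lift ((E ^^ j) (AL j)) * l 1"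
    unfolding BL unfolding lk qtr_pow_mult_lifts unfolding C_def C'_def k_def by (simp add: E_pow_conj[OF homog_AL])
  \<comment> \<open>The left factor \<open>B\<close> goes around the trace to the right end and
    returns through \<open>?L\<close>, with which it commutes. There it merges with the other
    \<open>B\<close> by idempotence.\<close>
  have "(E ^^ j) (B * r k 1 * B * ?L) = (E ^^ j) (r k 1 * B * ?L * B)"
  proof -
    have "homog (Suc j) (r k 1 * B * ?L)" unfolding k_def by (intro homog_mult homog_site2)
    then show ?thesis using cyc by (simp add: cyclic_def mult.assoc)
  qed
  also have "r k 1 * B * ?L * B = r k 1 * (B * B) * ?L"
    by (simp only: BLcomm[symmetric] mult.assoc)
  also have "\<dots> = r k 1 * C * lift (AL j) * C' * l k"
    unfolding BB by (simp only: BL mult.assoc)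
  also have "(E ^^ j) \<dots> = (E ^^ n) (AL j) * l 1"
    unfolding lk qtr_pow_mult_lifts unfolding C_def C'_def k_def n
    using E_pow_r_conj[OF homog_AL] by (simp only:)
  finally have 2: "(E ^^ j) (B * r k 1 * B * ?L) = (E ^^ n) (AL j) * l 1" .
  have "smul (emb (qnum q k)) (AL k) = smul (emb (q ^ j)) (B * ?L) - smul (emb (qnum q j)) (B * r k 1 * B * ?L)"
  proof -
    have "smul (emb (qnum q k)) (alg.hasym k (r k) k)
        = smul (emb (q ^ j)) B - smul (emb (qnum q j)) (B * r k 1 * B)"
      using alg.hasym_mirror[of k "r k" n] r_hecke_gens[of k] by (simp add: k_def n B_def)
    then have "smul (emb (qnum q k)) (alg.hasym k (r k) k) * ?L
        = (smul (emb (q ^ j)) B - smul (emb (qnum q j)) (B * r k 1 * B)) * ?L" by simp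
    then show ?thesis by (simp add: AL_def left_diff_distrib)
  qed
  from arg_cong[OF this, of "E ^^ j"]
  have "smul (emb (qnum q k)) ((E ^^ j) (AL k)) = smul (emb (q ^ j)) (lift ((E ^^ j) (AL j)) * l 1)
      - smul (emb (qnum q j)) ((E ^^ n) (AL j) * l 1)"
    unfolding E_pow_smul qtr_pow_diff 1 2 .
  moreover have "j - 1 = n" using n by simp
  ultimately show ?thesis by (simp only: k_def)
qed

section \<open>Translation of the defined operators into the graded ring\<close>

lemma tsupp_tmap_emb: "tsupp m X \<Longrightarrow> tsupp m (tmap emb X)"
  by (simp add: tsupp_def tmap_def)

lemma Gop_tmap: "Gop (tmap emb X) = gmap emb (Gop X)"
  by (rule gop_eqI) (simp add: ent_Gop tmap_def)

lemma Gop_antisym: "gmap emb (Gop (antisym q R m k)) = alg.hasym m (r m) k"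
proof (induction k)
  case (Suc k)
  show ?case
  proof (cases k)
    case (Suc n)
    let ?A = "antisym q R m (Suc n)"
    let ?T = "tdiff (tscale (q ^ Suc n) (tid m)) (tscale (qnum q (Suc n)) (two_site m R (Suc n)))"
    have "tsupp m ?T" by (intro tsupp_tdiff tsupp_tscale tsupp_tid tsupp_two_site)
    then have "Gop (tprod m [?A, ?T, ?A]) = Gop ?A * Gop ?T * Gop ?A"
      by (subst Gop_tprod[where m = m])
        (auto simp: mult.assoc homogD(2)[OF homog_Gop[OF tsupp_antisym]] intro: tsupp_antisym)
    moreover have "Gop ?T = smul (q ^ Suc n) (eu m) - smul (qnum q (Suc n)) (site2 m R (Suc n))"
      by (simp add: Gop_tdiff Gop_tscale eu_def site2_def)
    ultimately have "Gop (antisym q R m (Suc (Suc n))) = smul (1 / qnum q (Suc (Suc n)))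
        (Gop ?A * (smul (q ^ Suc n) (eu m) - smul (qnum q (Suc n)) (site2 m R (Suc n))) * Gop ?A)"
      by (simp only: antisym.simps Gop_tscale)
    then show ?thesis using Suc.IH Suc
      by (simp only: gmap_smul gmap_mult gmap_diff gmap_site2 gmap_eu alg.hasym.simps Rb_def)
  qed (simp add: eu_def[symmetric] gmap_eu)
qed (simp add: eu_def[symmetric] gmap_eu)

lemma Gop_L_bar: "Gop (L_bar emb R L m (Suc k)) = refl.ell m k"
proof (induction k)
  case (Suc k)
  have "Gop (L_bar emb R L m (Suc (Suc k))) = r m (Suc k) * Gop (L_bar emb R L m (Suc k)) * r' m (Suc k)"
    unfolding L_bar.simps
    by (subst Gop_tprod[where m = m])
      (auto simp: mult.assoc homogD(2)[OF homog_site2] Rb_def Ri_def site2_def[symmetric]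
        intro: tsupp_L_bar tsupp_two_site)
  then show ?case using Suc by simp
qed (simp only: L_bar.simps refl.ell.simps, simp only: site1_def One_nat_def)

lemma Gop_L_bars: "Gop (tprod m (map (L_bar emb R L m) [1..<k + 1])) = refl.Lam m k"
proof -
  have "Gop (tprod m (map (L_bar emb R L m) [1..<k + 1]))
      = prod_list (map (\<lambda>i. Gop (L_bar emb R L m i)) [1..<k + 1]) * eu m"
    by (subst Gop_tprod) (auto intro: tsupp_L_bar simp: comp_def)
  also have "\<dots> = refl.Lam m k"
  proof (induction k)
    case (Suc k)
    have "prod_list (map (\<lambda>i. Gop (L_bar emb R L m i)) [1..<Suc k + 1]) * eu m
        = prod_list (map (\<lambda>i. Gop (L_bar emb R L m i)) [1..<k + 1]) * eu m * refl.ell m k"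
      by (simp add: Gop_L_bar mult.assoc)
    then show ?case using Suc by simp
  qed simp
  finally show ?thesis .
qed

lemma Gop_antisym_L: "Gop (antisym_L emb q R L k) = AL k"
  unfolding antisym_L_def AL_def
  by (subst Gop_tmul[OF tsupp_tmap_emb[OF tsupp_antisym]])
    (simp only: Gop_tmap Gop_antisym Gop_L_bars)

lemma tsupp_antisym_L: "tsupp k (antisym_L emb q R L k)"
  unfolding antisym_L_def
  by (intro tsupp_tmul tsupp_tmap_emb tsupp_antisym tsupp_tprod) (auto intro: tsupp_L_bar)

section \<open>Operators on one copy as matrices\<close>

definition deg1_mat :: "('n, 'b) gop \<Rightarrow> 'b ^'n ^'n"
  where "deg1_mat X = (\<chi> i j. ent X [i] [j])"

lemma deg1_mat_mult: "deg1_mat (X * Y) = deg1_mat X ** deg1_mat Y"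
  by (simp add: deg1_mat_def matrix_matrix_mult_def ent_mult sum_tens_Cons)

lemma deg1_mat_diff: "deg1_mat (X - Y) = deg1_mat X - deg1_mat Y"
  by (simp add: deg1_mat_def vec_eq_iff)

lemma deg1_mat_smul: "deg1_mat (smul c X) = mat_scale c (deg1_mat X)"
  by (simp add: deg1_mat_def mat_scale_def)

lemma deg1_mat_l: "deg1_mat (l 1) = L"
  by (simp add: deg1_mat_def ent_site1 one_site_def tens_def vec_eq_iff)

text \<open>In degree 0 the operator \<open>S\<close> is a scalar, so its lift to one copy is that
  scalar times the identity. Being noncommutative, the scalar stays on the left.\<close>

lemma deg1_mat_lift: "deg1_mat (lift S) ** M = mat_scale (ent S [] []) M"
proof -
  have e: "ent (lift S) [i] [j] = (if i = j then ent S [] [] else 0)" for i j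
    using ent_lift(3)[of S "[]" i "[]" j] by simp
  have "(\<Sum>k\<in>UNIV. ent (lift S) [i] [k] * M $ k $ j)
      = (\<Sum>k\<in>UNIV. if k = i then ent S [] [] * M $ i $ j else 0)" for i j
    by (rule sum.cong) (auto simp: e)
  then show ?thesis
    by (simp add: deg1_mat_def mat_scale_def matrix_matrix_mult_def vec_eq_iff)
qed

lemma L_bracket_eq: "L_bracket emb q R D L (Suc n) = deg1_mat ((E ^^ n) (AL (Suc n)))"
proof -
  have "Gop (qtrace Db (Suc n) 2 (antisym_L emb q R L (Suc n))) = (E ^^ n) (AL (Suc n))"
    using Gop_qtrace[OF tsupp_antisym_L, of 2 "Suc n" Db] by (simp add: Gop_antisym_L)
  then have "ent (Gop (qtrace Db (Suc n) 2 (antisym_L emb q R L (Suc n)))) [i] [j]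
      = ent ((E ^^ n) (AL (Suc n))) [i] [j]" for i j by simp
  then show ?thesis by (simp add: L_bracket_def deg1_mat_def vec_eq_iff ent_Gop Db_def)
qed

lemma sigma_L_eq: "sigma_L emb q R D L j = ent ((E ^^ j) (AL j)) [] []"
proof (cases "j = 0")
  \<comment> \<open>The operator \<open>AL 0\<close> is \<open>eu 0\<close>, whose entry at the
    empty word is 1, in accordance with sigma_0 = 1.\<close>
  case True
  then show ?thesis by (simp add: sigma_L_def AL_def ent_eu)
next
  case False
  have "Gop (qtrace Db j 1 (antisym_L emb q R L j)) = (E ^^ j) (AL j)"
    using Gop_qtrace[OF tsupp_antisym_L, of 1 j Db] by (simp add: Gop_antisym_L)
  from arg_cong[OF this, of "\<lambda>X. ent X [] []"] show ?thesis
    using False by (simp add: sigma_L_def ent_Gop Db_def)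
qed

lemma mat_scale_mult: "mat_scale c (M ** N) = mat_scale c M ** (N :: 'b ^'n ^'n)"
  by (simp add: mat_scale_def matrix_matrix_mult_def sum_distrib_left mult.assoc)

lemma mat_scale_scale: "mat_scale c (mat_scale d M) = mat_scale (c * d) (M :: 'b ^'n ^'n)"
  by (simp add: mat_scale_def mult.assoc)

lemma mat_scale_minus: "mat_scale c (- M) = - mat_scale c (M :: 'b ^'n ^'n)"
  by (simp add: mat_scale_def vec_eq_iff)

lemma L_bracket_recursion:
  assumes "1 \<le> j"
  shows "mat_scale (emb (qnum q (Suc j))) (L_bracket emb q R D L (Suc j)) =
    mat_scale (emb (q ^ j) * sigma_L emb q R D L j) L
      - mat_scale (emb (qnum q j)) (L_bracket emb q R D L j) ** L"
proof -
  obtain n where n: "j = Suc n" using assms by (cases j) auto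
  from arg_cong[OF newton_recursion[OF assms], of deg1_mat] show ?thesis
    by (simp only: deg1_mat_smul deg1_mat_diff deg1_mat_mult deg1_mat_l deg1_mat_lift
        sigma_L_eq[symmetric] L_bracket_eq[symmetric] mat_scale_scale mat_scale_mult n diff_Suc_1)
qed

text \<open>Powers are defined by multiplication from the left, while the recursion multiplies by
  \<open>L\<close> from the right.\<close>

lemma mat_power_Suc_right: "mat_power M (Suc k) = mat_power M k ** (M :: 'b ^'n ^'n)"
  by (induction k) (simp_all add: matrix_mul_assoc)

lemma matrix_minus_mult: "- M ** N = - (M ** (N :: 'b ^'n ^'n))" "M ** - N = - (M ** (N :: 'b ^'n ^'n))"
  by (simp_all add: matrix_matrix_mult_def vec_eq_iff sum_negf)

lemma matrix_sum_mult: "(\<Sum>j\<in>A. M j) ** N = (\<Sum>j\<in>A. M j ** (N :: 'b ^'n ^'n))"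
  by (induction A rule: infinite_finite_induct)
    (simp_all add: matrix_matrix_mult_def vec_eq_iff distrib_right sum.distrib)

text \<open>Multiplying the identity for k by \<open>-L\<close> from the right raises each power of
  \<open>-L\<close> by one, and the remaining term of \<open>L_bracket_recursion\<close> is the
  summand j = k of the identity for k + 1.\<close>

lemma cayley_hamilton_newton:
  assumes "k \<ge> 1"
  shows "mat_scale (emb (qnum q k)) (L_bracket emb q R D L k) =
    - (\<Sum>j = 0..k - 1. mat_scale (emb (q ^ j) * sigma_L emb q R D L j) (mat_power (- L) (k - j)))"
  using assms
proof (induction k rule: dec_induct)
  case base
  have "L_bracket emb q R D L 1 = L"
    using L_bracket_eq[of 0] deg1_mat_l by (simp add: AL_def)
  moreover have "qnum q 1 = 1" by simp
  ultimately show ?case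
    by (simp only: diff_self_eq_0 atLeastAtMost_singleton)
      (simp add: sigma_L_def mat_scale_def vec_eq_iff)
next
  case (step k)
  let ?c = "\<lambda>j. emb (q ^ j) * sigma_L emb q R D L j"
  have "mat_scale (?c j) (mat_power (- L) (Suc k - j)) = - (mat_scale (?c j) (mat_power (- L) (k - j)) ** L)"
    if "j \<le> k - 1" for j
  proof -
    have "Suc k - j = Suc (k - j)" using that by simp
    then show ?thesis
      by (simp only: mat_power_Suc_right matrix_minus_mult mat_scale_minus mat_scale_mult)
  qed
  then have S: "(\<Sum>j = 0..k - 1. mat_scale (?c j) (mat_power (- L) (Suc k - j)))
      = - ((\<Sum>j = 0..k - 1. mat_scale (?c j) (mat_power (- L) (k - j))) ** L)"
    by (simp add: matrix_sum_mult sum_negf)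
  \<comment> \<open>The additional summand j = k carries the first power of
    \<open>-L\<close>.\<close>
  have "{0..Suc k - 1} = insert k {0..k - 1}" using step by auto
  then have "(\<Sum>j = 0..Suc k - 1. mat_scale (?c j) (mat_power (- L) (Suc k - j)))
      = mat_scale (?c k) (- L) - (\<Sum>j = 0..k - 1. mat_scale (?c j) (mat_power (- L) (k - j))) ** L"
    using step S by simp
  then show ?case
    using L_bracket_recursion[OF step(1)] by (simp add: step.IH mat_scale_minus matrix_minus_mult)
qed

end

theorem mainTheorem4:
  fixes R :: "'a::field ^('n::finite \<times> 'n) ^('n \<times> 'n)"
    and q :: 'a
    and D :: "'a ^'n ^'n"
    and emb :: "'a \<Rightarrow> 'b::ring_1"
    and L :: "'b ^'n ^'n"
    and k :: nat
  assumes "yang_baxter R"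
    and "hecke_type q R"
    and "q \<noteq> 0" and "\<not> root_of_unity q"
    and "is_D_matrix R D"
    and "rlrl_algebra emb R L"
    and "k \<ge> 1"
  shows "mat_scale (emb (qnum q k)) (L_bracket emb q R D L k) =
    - (\<Sum>j = 0..k - 1. mat_scale (emb (q ^ j) * sigma_L emb q R D L j) (mat_power (- L) (k - j)))"
proof -
  interpret rlrl_setup R D emb q L
    using assms by unfold_locales (auto simp: rlrl_algebra_def)
  show ?thesis using assms(7) by (rule cayley_hamilton_newton)
qed

end
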